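(* Let $u:\mathbb{U}\to\mathbb{R}^m$ be harmonic on the unit disk $\mathbb{U}$, $S=u(\mathbb{U})$, and suppose that $A=A(S)$ is finite and that $u$ is conformal. Let $F:\mathbb{U}\to\mathbb{C}^m$ be a holomorphic function with $u=\operatorname{Re}F$, $F(z)=\sum_{k\ge0}\hat F(k)z^k$. Then: d1) $$A=\int_{\mathbb{U}}|D_1u|^2\,dx\,dy=\frac{\underline{D}[F]}{2}=\frac{\pi}{2}\sum_{k=1}^\infty k|\hat F(k)|^2.$$ d2) In particular, $\pi\Lambda_u^2(0)\le D[u]$, with equality if and only if (ii): $\gamma_u$ is a circle given by $u_k=a_kx-b_ky$, $k=1,2,\dots,m$, where $a=(a_1,\dots,a_m)$ and $b=(b_1,\dots,b_m)$ in $\mathbb{R}^m$ satisfy $|a|=|b|$ and $a\cdot b=0$. d3) If $u$ is continuous on $\overline{\mathbb{U}}$ and $\gamma_u$ is rectifiable with length $L$, then $2\pi\Lambda_u(0)\le L$, with equality if and only if (ii) holds.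
   Context: $\mathbb{U}$ is the open unit disk in $\mathbb{C}$, $z=x+iy$; $u=(u_1,\dots,u_m)$, $D_1u=u'_x$, $D_2u=u'_y$. $u$ is conformal if $|D_1u|=|D_2u|$ and $D_1u\cdot D_2u=0$ on $\mathbb{U}$. $J_u=\sqrt{|D_1u|^2|D_2u|^2-(D_1u\cdot D_2u)^2}$ and $A(S)=A(u)=\int_{\mathbb{U}}J_u\,dx\,dy$. $D[u]=\int_{\mathbb{U}}(|D_1u|^2+|D_2u|^2)\,dx\,dy$ and $\underline{D}[F]=\int_{\mathbb{U}}|F'(z)|^2\,dx\,dy$, with Euclidean/Hermitian norms. $\Lambda_u(0)$ is the operator norm of the differential of $u$ at $0$. $\gamma_u$ is the boundary curve $\gamma_u(t)=u(e^{it})$, $t\in[0,2\pi]$.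
   Formalization: In d2 the equality case is stated for πΛ_u²(0) = D[u]/2 (the bound with D[u]/2 is added), since u=(x,−y) satisfies (ii) but has D[u]=2π; in (ii) the formula is u_k = u_k(0)+a_k x−b_k y, as u=(1+x,−y) has equality in d3 without the literal form. *)

theory Defs
  imports "HOL-Complex_Analysis.Complex_Analysis"
begin

abbreviation unit_disk :: "complex set" where
  "unit_disk \<equiv> ball 0 1"

definition D1 :: "(complex \<Rightarrow> real ^ 'm) \<Rightarrow> complex \<Rightarrow> real ^ 'm" where
  "D1 u z = vector_derivative (\<lambda>t. u (z + complex_of_real t)) (at 0)"

definition D2 :: "(complex \<Rightarrow> real ^ 'm) \<Rightarrow> complex \<Rightarrow> real ^ 'm" where
  "D2 u z = vector_derivative (\<lambda>t. u (z + \<i> * complex_of_real t)) (at 0)"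

text \<open>
  Class \<open>C\<^sup>2\<close> with vanishing Laplacian. The differentiability conjuncts guarantee that
  the values of \<open>D1\<close> and \<open>D2\<close> occurring in the other conjuncts are genuine partial derivatives.
\<close>

definition harmonic_map_on :: "(complex \<Rightarrow> real ^ 'm) \<Rightarrow> complex set \<Rightarrow> bool" where
  "harmonic_map_on u S \<longleftrightarrow> open S
     \<and> u differentiable_on S \<and> D1 u differentiable_on S \<and> D2 u differentiable_on S
     \<and> continuous_on S (D1 (D1 u)) \<and> continuous_on S (D2 (D1 u))
     \<and> continuous_on S (D1 (D2 u)) \<and> continuous_on S (D2 (D2 u))
     \<and> (\<forall>z\<in>S. D1 (D1 u) z + D2 (D2 u) z = 0)"

definition conformal_map_on :: "(complex \<Rightarrow> real ^ 'm) \<Rightarrow> complex set \<Rightarrow> bool" where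
  "conformal_map_on u S \<longleftrightarrow> (\<forall>z\<in>S. norm (D1 u z) = norm (D2 u z) \<and> D1 u z \<bullet> D2 u z = 0)"

definition area_jacobian :: "(complex \<Rightarrow> real ^ 'm) \<Rightarrow> complex \<Rightarrow> real" where
  "area_jacobian u z =
     sqrt ((norm (D1 u z))\<^sup>2 * (norm (D2 u z))\<^sup>2 - (D1 u z \<bullet> D2 u z)\<^sup>2)"

text \<open>
  All integrands below are nonnegative, so the integrals are taken with values in \<open>[0, \<infinity>]\<close>;
  finiteness is then a statement about the value and no integrability side condition is needed.
\<close>

definition surface_area :: "(complex \<Rightarrow> real ^ 'm) \<Rightarrow> ennreal" where
  "surface_area u = (\<integral>\<^sup>+z\<in>unit_disk. ennreal (area_jacobian u z) \<partial>lborel)"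

definition dirichlet :: "(complex \<Rightarrow> real ^ 'm) \<Rightarrow> ennreal" where
  "dirichlet u =
     (\<integral>\<^sup>+z\<in>unit_disk. ennreal ((norm (D1 u z))\<^sup>2 + (norm (D2 u z))\<^sup>2) \<partial>lborel)"

definition holomorphic_map_on :: "(complex \<Rightarrow> complex ^ 'm) \<Rightarrow> complex set \<Rightarrow> bool" where
  "holomorphic_map_on F S \<longleftrightarrow> (\<forall>j. (\<lambda>z. F z $ j) holomorphic_on S)"

definition deriv_map :: "(complex \<Rightarrow> complex ^ 'm) \<Rightarrow> complex \<Rightarrow> complex ^ 'm" where
  "deriv_map F z = (\<chi> j. deriv (\<lambda>w. F w $ j) z)"

definition complex_dirichlet :: "(complex \<Rightarrow> complex ^ 'm) \<Rightarrow> ennreal" where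
  "complex_dirichlet F =
     (\<integral>\<^sup>+z\<in>unit_disk. ennreal ((norm (deriv_map F z))\<^sup>2) \<partial>lborel)"

definition max_dilation :: "(complex \<Rightarrow> real ^ 'm) \<Rightarrow> complex \<Rightarrow> real" where
  "max_dilation u z = onorm (frechet_derivative u (at z))"

definition boundary_curve :: "(complex \<Rightarrow> real ^ 'm) \<Rightarrow> real \<Rightarrow> real ^ 'm" where
  "boundary_curve u t = u (cis t)"

text \<open>Length as the supremum of the lengths of inscribed polygons.\<close>

definition curve_length :: "(real \<Rightarrow> 'a::metric_space) \<Rightarrow> real \<Rightarrow> real \<Rightarrow> ennreal" where
  "curve_length g a b =
     (SUP (n, t) \<in> {(n :: nat, t :: nat \<Rightarrow> real). t 0 = a \<and> t n = b \<and> (\<forall>i<n. t i \<le> t (Suc i))}.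
        \<Sum>i<n. ennreal (dist (g (t i)) (g (t (Suc i)))))"

definition rectifiable :: "(real \<Rightarrow> 'a::metric_space) \<Rightarrow> real \<Rightarrow> real \<Rightarrow> bool" where
  "rectifiable g a b \<longleftrightarrow> curve_length g a b < \<infinity>"

text \<open>
  On \<open>S\<close>, \<open>u\<close> is \<open>u\<^sub>k = a\<^sub>k x - b\<^sub>k y\<close> up to translation by \<open>u 0\<close>. On the unit circle such a
  map is \<open>t \<mapsto> u 0 + cos t a - sin t b\<close>, which traces the circle about \<open>u 0\<close> of radius
  \<open>norm a\<close> in the plane spanned by \<open>a\<close> and \<open>b\<close>; \<open>a = b = 0\<close> (a single point) is allowed.
\<close>

definition circle_form_on :: "(complex \<Rightarrow> real ^ 'm) \<Rightarrow> complex set \<Rightarrow> bool" where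
  "circle_form_on u S \<longleftrightarrow>
     (\<exists>a b :: real ^ 'm. norm a = norm b \<and> a \<bullet> b = 0
        \<and> (\<forall>z\<in>S. \<forall>k. u z $ k = u 0 $ k + (a $ k * Re z - b $ k * Im z)))"

end

theory Submission
  imports Defs
begin

text \<open>
  Write \<open>\<Lambda>\<close> for \<open>max_dilation u 0\<close> and \<open>L\<close> for the length of the boundary curve.
  Since \<open>u = Re F\<close>, the partial derivatives of \<open>u\<close> are \<open>Re F'\<close> and \<open>- Im F'\<close>, so conformality
  gives \<open>\<bar>F'\<bar>\<^sup>2 = 2 \<bar>D1 u\<bar>\<^sup>2\<close>, the Jacobian is \<open>\<bar>D1 u\<bar>\<^sup>2\<close>, the differential at \<open>z\<close> is \<open>\<bar>D1 u z\<bar>\<close>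
  times a linear isometry, and all three integrals over the disk agree up to factors of two.
  The coefficient formula is then Parseval's identity on the disk, \<open>nn_integral_disk_norm_square_power_series\<close>.
  The bound by the area keeps only the first term of the series, which is \<open>\<pi> \<Lambda>\<^sup>2\<close>; equality kills
  all higher coefficients, so that \<open>F'\<close> is constant, which is the circle form.
  
  For the length, approximate circles by the \<open>n\<close>-th roots of unity. If \<open>\<bar>z\<bar> = 1\<close> and \<open>\<zeta>\<close> is
  a primitive \<open>n\<close>-th root of unity, the closed polygon through the points \<open>u (\<zeta>\<^sup>i z)\<close> is inscribed in the
  boundary curve and has perimeter at most \<open>L\<close>. A sum of norms of vector-valued harmonic functions obeys
  the maximum principle (\<open>sum_norm_maximum_principle\<close>), so the same bound holds for \<open>\<bar>z\<bar> < 1\<close>, where \<open>u\<close> is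
  smooth and each chord is \<open>\<bar>D1 u\<bar>\<close> times the distance of its parameters, up to a quadratic error.
  Hence on the circle of radius \<open>R\<close> the mean of \<open>\<bar>F'\<bar>\<close> over the rotates of a point is at most
  \<open>\<surd>2 L / (2 \<pi> R)\<close> in the limit. The maximum principle, now applied to \<open>F'\<close>, carries this
  bound to every point inside, and \<open>R \<rightarrow> 1\<close> removes the factor \<open>1 / R\<close>
  (\<open>circle_mean_deriv_map_le\<close>). At the origin it reads \<open>\<surd>2 \<Lambda> \<le> \<surd>2 L / (2 \<pi>)\<close>.
  
  If \<open>L = 2 \<pi> \<Lambda>\<close>, the circle means of \<open>\<bar>F'\<bar>\<close> do not exceed \<open>\<bar>F' 0\<bar>\<close> in the limit. With \<open>e\<close> the direction of
  \<open>F' 0\<close>, the nonnegative function \<open>\<bar>F'\<bar> - F' \<bullet> e\<close> therefore has means tending to zero and vanishes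
  identically. So \<open>F' = \<bar>F'\<bar> e\<close>, and \<open>\<bar>F'\<bar>\<close> is holomorphic and real valued, hence constant.
\<close>

section \<open>Lebesgue measure on the disk\<close>

text \<open>
  The image measure \<open>M\<close> is again translation invariant, and translation invariant measures that are finite and
  positive on the unit ball \<open>U\<close> are proportional: evaluating the double integral of \<open>1\<^sub>A (x + y) 1\<^sub>U y\<close> in both orders,
  with a translation in either variable, gives \<open>lborel A * M U = M A * lborel U\<close>. An isometry
  preserves \<open>U\<close>, so the factor of proportionality is one.
\<close>

lemma lborel_distr_linear_isometry:
  fixes f :: "'a::euclidean_space \<Rightarrow> 'a"
  assumes lin: "linear f" and iso: "\<And>x. norm (f x) = norm x"
  shows "distr lborel borel f = (lborel :: 'a measure)"
proof (rule measure_eqI)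
  show "sets (distr lborel borel f) = sets (lborel :: 'a measure)" by simp
next
  fix A assume "A \<in> sets (distr lborel borel f)"
  then have A [measurable]: "A \<in> sets borel" by simp
  have f [measurable]: "f \<in> borel_measurable borel"
    using lin by (intro borel_measurable_continuous_onI linear_continuous_on)
                 (simp add: linear_conv_bounded_linear)
  define M where "M = distr lborel borel f"
  have [measurable_cong]: "sets M = sets borel" by (simp add: M_def)
  have inj: "inj f"
    using iso linear_injective_0[OF lin] by (metis norm_eq_zero)
  then have surj: "surj f" using linear_injective_imp_surjective[OF lin] by simp
  have shift: "(\<integral>\<^sup>+y. g (y + c) \<partial>M) = (\<integral>\<^sup>+y. g y \<partial>M)"
    if [measurable]: "g \<in> borel_measurable borel" for g :: "'a \<Rightarrow> ennreal" and c
  proof -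
    obtain d where d: "f d = c" using surj by (metis surj_def)
    have "(\<integral>\<^sup>+y. g (y + c) \<partial>M) = (\<integral>\<^sup>+x. g (f (x + d)) \<partial>lborel)"
      by (simp add: M_def nn_integral_distr linear_add[OF lin] d)
    also have "\<dots> = (\<integral>\<^sup>+x. g (f x) \<partial>distr lborel borel ((+) d))"
      by (simp add: nn_integral_distr add.commute)
    also have "\<dots> = (\<integral>\<^sup>+y. g y \<partial>M)"
      by (simp add: M_def nn_integral_distr lborel_distr_plus)
    finally show ?thesis .
  qed
  have lshift: "(\<integral>\<^sup>+x. g (x + c) \<partial>lborel) = (\<integral>\<^sup>+x. g x \<partial>lborel)"
    if [measurable]: "g \<in> borel_measurable borel" for g :: "'a \<Rightarrow> ennreal" and c
  proof -
    have "(\<integral>\<^sup>+x. g (x + c) \<partial>lborel) = (\<integral>\<^sup>+x. g x \<partial>distr lborel borel ((+) c))"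
      by (simp add: nn_integral_distr add.commute)
    then show ?thesis by (simp add: lborel_distr_plus)
  qed
  have Mball: "emeasure M (ball 0 1) = emeasure lborel (ball (0::'a) 1)"
  proof -
    have "f -` ball 0 1 = ball 0 1" using iso by auto
    then show ?thesis by (simp add: M_def emeasure_distr)
  qed
  interpret M: sigma_finite_measure M
  proof
    define C where "C = (\<lambda>n::nat. ball (0::'a) (real n))"
    have "emeasure M (C n) < \<infinity>" for n
    proof -
      have "f -` C n = C n" using iso by (auto simp: C_def)
      then show ?thesis
        using emeasure_lborel_ball_finite[of "0::'a" "real n"]
        by (simp add: M_def emeasure_distr C_def)
    qed
    moreover have "(\<Union>n. C n) = UNIV"
      by (auto simp: C_def intro: reals_Archimedean2)
    ultimately show "\<exists>A. countable A \<and> A \<subseteq> sets M \<and> \<Union>A = space M \<and> (\<forall>a\<in>A. emeasure M a \<noteq> \<infinity>)"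
      by (intro exI[of _ "range C"]) (auto simp: C_def M_def less_top)
  qed
  define U where "U = ball (0::'a) 1"
  have U [measurable]: "U \<in> sets borel" by (simp add: U_def)
  interpret P: pair_sigma_finite lborel M ..
  have "emeasure lborel A * emeasure M U
      = (\<integral>\<^sup>+y. (\<integral>\<^sup>+x. indicator A x * indicator U y \<partial>lborel) \<partial>M)"
    by (simp add: nn_integral_multc nn_integral_cmult_indicator)
  also have "\<dots> = (\<integral>\<^sup>+y. (\<integral>\<^sup>+x. indicator A (x + y) * indicator U y \<partial>lborel) \<partial>M)"
    by (intro nn_integral_cong lshift[where g="\<lambda>x. indicator A x * indicator U _", symmetric]) measurable
  also have "\<dots> = (\<integral>\<^sup>+x. (\<integral>\<^sup>+y. indicator A (x + y) * indicator U y \<partial>M) \<partial>lborel)"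
    by (rule P.Fubini') measurable
  also have "\<dots> = (\<integral>\<^sup>+x. (\<integral>\<^sup>+y. indicator A y * indicator U (y - x) \<partial>M) \<partial>lborel)"
  proof (rule nn_integral_cong)
    fix x :: 'a
    show "(\<integral>\<^sup>+y. indicator A (x + y) * indicator U y \<partial>M)
        = (\<integral>\<^sup>+y. indicator A y * indicator U (y - x) \<partial>M)"
      using shift[of "\<lambda>y. indicator A y * indicator U (y - x)" x]
      by (simp add: add.commute)
  qed
  also have "\<dots> = (\<integral>\<^sup>+y. (\<integral>\<^sup>+x. indicator A y * indicator U (y - x) \<partial>lborel) \<partial>M)"
    by (rule P.Fubini'[symmetric]) measurable
  also have "\<dots> = (\<integral>\<^sup>+y. indicator A y * emeasure lborel U \<partial>M)"
  proof (rule nn_integral_cong)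
    fix y :: 'a
    have "(\<integral>\<^sup>+x. indicator U (y - x) \<partial>lborel)
        = (\<integral>\<^sup>+x. indicator U (y - (x + y)) \<partial>lborel)"
      by (rule lshift[symmetric]) measurable
    also have "\<dots> = (\<integral>\<^sup>+x. indicator U x \<partial>lborel)"
      by (intro nn_integral_cong) (auto simp: indicator_def U_def)
    finally show "(\<integral>\<^sup>+x. indicator A y * indicator U (y - x) \<partial>lborel)
        = indicator A y * emeasure lborel U"
      by (simp add: nn_integral_cmult)
  qed
  also have "\<dots> = emeasure M A * emeasure lborel U"
    by (simp add: nn_integral_multc)
  finally have "emeasure lborel A * emeasure lborel U = emeasure M A * emeasure lborel U"
    by (simp add: Mball U_def)
  moreover have "emeasure lborel U \<noteq> 0" "emeasure lborel U \<noteq> \<infinity>"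
    using emeasure_lborel_ball_finite[of "0::'a" 1] by (auto simp: U_def emeasure_ball unit_ball_vol_pos less_imp_neq[symmetric])
  ultimately show "emeasure (distr lborel borel f) A = emeasure lborel A"
    unfolding M_def[symmetric] using mult_divide_eq_ennreal by (metis infinity_ennreal_def)
qed

lemma borel_measurable_continuous_on_disk:
  assumes "continuous_on unit_disk (g :: complex \<Rightarrow> real)"
  shows "(\<lambda>z. ennreal (g z) * indicator unit_disk z) \<in> borel_measurable borel"
proof -
  have "(\<lambda>z. indicator unit_disk z *\<^sub>R g z) \<in> borel_measurable borel"
    by (intro borel_measurable_continuous_on_indicator assms) simp
  then have "(\<lambda>z. ennreal (indicator unit_disk z *\<^sub>R g z)) \<in> borel_measurable borel"
    by measurable
  also have "(\<lambda>z. ennreal (indicator unit_disk z *\<^sub>R g z)) = (\<lambda>z. ennreal (g z) * indicator unit_disk z)"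
    by (auto simp: indicator_def)
  finally show ?thesis .
qed

lemma nn_integral_lborel_rotate:
  fixes g :: "complex \<Rightarrow> ennreal"
  assumes [measurable]: "g \<in> borel_measurable borel" and c: "cmod c = 1"
  shows "(\<integral>\<^sup>+z. g (c * z) \<partial>lborel) = (\<integral>\<^sup>+z. g z \<partial>lborel)"
proof -
  have "(\<integral>\<^sup>+z. g (c * z) \<partial>lborel) = (\<integral>\<^sup>+z. g z \<partial>distr lborel borel (\<lambda>z. c * z))"
    by (simp add: nn_integral_distr)
  also have "distr lborel borel (\<lambda>z. c * z) = lborel"
    by (rule lborel_distr_linear_isometry) (auto simp: norm_mult c linear_times)
  finally show ?thesis .
qed

text \<open>
  Polar coordinates are replaced by the layer cake formula: \<open>\<bar>z\<bar>\<^sup>2\<^sup>n\<close> is the integral of \<open>\<rho> s = 2 n s\<^bsup>2n-1\<^esup>\<close> over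
  \<open>s \<le> \<bar>z\<bar>\<close>, and after exchanging the integrals only areas of annuli remain.
\<close>

lemma nn_integral_disk_norm_power:
  "(\<integral>\<^sup>+z\<in>unit_disk. ennreal (cmod z ^ (2 * n)) \<partial>lborel) = ennreal (pi / real (Suc n))"
proof (cases "n = 0")
  case True
  then show ?thesis by (simp add: emeasure_ball unit_ball_vol_2)
next
  case False
  define \<rho> where "\<rho> = (\<lambda>s::real. 2 * real n * s ^ (2 * n - 1))"
  have [measurable]: "\<rho> \<in> borel_measurable borel" by (simp add: \<rho>_def)
  have layer: "(\<integral>\<^sup>+s\<in>{0..b}. ennreal (\<rho> s) \<partial>lborel) = ennreal (b ^ (2 * n))" if "0 \<le> b" for b
  proof -
    have "(\<integral>\<^sup>+s\<in>{0..b}. ennreal (\<rho> s) \<partial>lborel) = ennreal (b ^ (2 * n) - 0 ^ (2 * n))"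
      using that False unfolding \<rho>_def
      by (intro nn_integral_FTC_Icc) (auto intro!: derivative_eq_intros)
    then show ?thesis using False by (simp add: zero_power)
  qed
  have "(\<integral>\<^sup>+z\<in>unit_disk. ennreal (cmod z ^ (2 * n)) \<partial>lborel)
      = (\<integral>\<^sup>+z. (\<integral>\<^sup>+s. ennreal (\<rho> s) * indicator {0..1} s * indicator {z. s \<le> cmod z \<and> cmod z < 1} z \<partial>lborel) \<partial>lborel)"
  proof (rule nn_integral_cong)
    fix z :: complex
    show "ennreal (cmod z ^ (2 * n)) * indicator unit_disk z =
       (\<integral>\<^sup>+s. ennreal (\<rho> s) * indicator {0..1} s * indicator {z. s \<le> cmod z \<and> cmod z < 1} z \<partial>lborel)"
      unfolding layer[OF norm_ge_zero, symmetric]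
      by (subst nn_integral_multc[symmetric]) (auto intro!: nn_integral_cong simp: indicator_def)
  qed
  also have "\<dots> = (\<integral>\<^sup>+s. (\<integral>\<^sup>+z. ennreal (\<rho> s) * indicator {0..1} s * indicator {z. s \<le> cmod z \<and> cmod z < 1} z \<partial>lborel) \<partial>lborel)"
  proof -
    have "{p::real \<times> complex. fst p \<le> cmod (snd p)} \<inter> {p. cmod (snd p) < 1} \<in> sets borel"
      by (intro sets.Int borel_closed borel_open closed_Collect_le open_Collect_less continuous_intros)
    then have "{p::real \<times> complex. fst p \<le> cmod (snd p) \<and> cmod (snd p) < 1} \<in> sets borel"
      by (simp add: Collect_conj_eq)
    then have [measurable]: "{p::real \<times> complex. fst p \<le> cmod (snd p) \<and> cmod (snd p) < 1} \<in> sets (lborel \<Otimes>\<^sub>M lborel)"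
      by (simp only: sets_pair_measure_cong[OF sets_lborel sets_lborel] borel_prod)
    have "(\<lambda>p. ennreal (\<rho> (fst p)) * indicator {0..1} (fst p) * indicator {p. fst p \<le> cmod (snd p) \<and> cmod (snd p) < 1} p) \<in> borel_measurable (lborel \<Otimes>\<^sub>M lborel)"
      by measurable
    then show ?thesis
      by (intro lborel_pair.Fubini') (simp add: indicator_def case_prod_beta)
  qed
  also have "\<dots> = (\<integral>\<^sup>+s. ennreal (\<rho> s * (pi * (1 - s\<^sup>2))) * indicator {0..1} s \<partial>lborel)"
  proof (rule nn_integral_cong)
    fix s :: real
    show "(\<integral>\<^sup>+z. ennreal (\<rho> s) * indicator {0..1} s * indicator {z. s \<le> cmod z \<and> cmod z < 1} z \<partial>lborel)
        = ennreal (\<rho> s * (pi * (1 - s\<^sup>2))) * indicator {0..1} s"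
    proof (cases "s \<in> {0..1}")
      case True
      have eq: "{z. s \<le> cmod z \<and> cmod z < 1} = ball 0 1 - ball 0 s" by auto
      have "emeasure lborel {z. s \<le> cmod z \<and> cmod z < 1} = ennreal pi - ennreal (pi * s\<^sup>2)"
        using True unfolding eq
        by (subst emeasure_Diff) (auto simp: emeasure_ball unit_ball_vol_2)
      also have "\<dots> = ennreal (pi * (1 - s\<^sup>2))"
        by (simp add: ennreal_minus algebra_simps)
      finally show ?thesis
        using True by (simp add: nn_integral_cmult_indicator eq ennreal_mult' \<rho>_def power_le_one)
    qed simp
  qed
  also have "\<dots> = ennreal (pi * (1 ^ (2 * n) - real n / real (Suc n) * 1 ^ (2 * n + 2)) 
       - pi * (0 ^ (2 * n) - real n / real (Suc n) * 0 ^ (2 * n + 2)))"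
  proof (rule nn_integral_FTC_Icc)
    fix s :: real
    obtain m where m: "n = Suc m" using False by (cases n) auto
    show "((\<lambda>s. pi * (s ^ (2 * n) - real n / real (Suc n) * s ^ (2 * n + 2))) has_real_derivative
          \<rho> s * (pi * (1 - s\<^sup>2))) (at s)"
      unfolding \<rho>_def m
      by (rule derivative_eq_intros refl | simp)+ (simp add: field_simps power2_eq_square)
  qed (auto simp: \<rho>_def power_le_one)
  also have "\<dots> = ennreal (pi / real (Suc n))"
    using False by (simp add: field_simps zero_power)
  finally show ?thesis .
qed

section \<open>Means over roots of unity\<close>

text \<open>
  The average over the rotates of \<open>z\<close> by the \<open>n\<close>-th roots of unity stands in for the average over the
  circle about the origin through \<open>z\<close>. It is a finite sum, so it commutes with integration over the disk and with the maximum principle,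
  and it is exact on trigonometric polynomials of degree less than \<open>n\<close>.
\<close>

definition circle_mean :: "nat \<Rightarrow> (complex \<Rightarrow> 'a::real_vector) \<Rightarrow> complex \<Rightarrow> 'a" where
  "circle_mean n \<phi> z = (\<Sum>i<n. \<phi> (cis (2 * pi * real i / real n) * z)) /\<^sub>R real n"

lemma sum_roots_of_unity_orthogonal:
  assumes "j < n" "k < n"
  shows "(\<Sum>i<n. cis (2 * pi * real i / real n) ^ j * cnj (cis (2 * pi * real i / real n) ^ k))
         = (if j = k then of_nat n else 0)"
proof -
  define \<omega> where "\<omega> = cis (2 * pi / real n)"
  define q where "q = \<omega> ^ j * cnj (\<omega> ^ k)"
  have n: "n \<noteq> 0" using assms by simp
  have \<omega>i: "cis (2 * pi * real i / real n) = \<omega> ^ i" for i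
    unfolding \<omega>_def Complex.DeMoivre by (simp add: mult_ac)
  have term_q: "cis (2 * pi * real i / real n) ^ j * cnj (cis (2 * pi * real i / real n) ^ k) = q ^ i" for i
    unfolding \<omega>i q_def by (simp add: power_mult_distrib mult.commute flip: power_mult)
  have \<omega>n: "\<omega> ^ n = 1"
    unfolding \<omega>_def Complex.DeMoivre using n by simp
  have \<omega>cnj: "\<omega> ^ k * cnj (\<omega> ^ k) = 1"
    by (simp add: \<omega>_def complex_norm_square[symmetric] norm_power del: complex_cnj_power)
  have qn: "q ^ n = 1"
  proof -
    have "(\<omega> ^ m) ^ n = 1" for m
      using \<omega>n by (metis mult.commute power_mult power_one)
    then show ?thesis
      by (simp add: q_def power_mult_distrib del: complex_cnj_power flip: complex_cnj_power)
  qed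
  have q1: "q = 1 \<longleftrightarrow> j = k"
  proof
    assume "q = 1"
    then have "\<omega> ^ j * (\<omega> ^ k * cnj (\<omega> ^ k)) = \<omega> ^ k"
      unfolding q_def by (metis mult.assoc mult.commute mult_1)
    then have "\<omega> ^ j = \<omega> ^ k" by (simp only: \<omega>cnj mult_1_right)
    moreover have "\<omega> ^ i = exp (2 * of_real pi * \<i> * of_nat i / of_nat n)" for i
      unfolding \<omega>_def Complex.DeMoivre by (simp add: cis_conv_exp mult_ac)
    ultimately show "j = k"
      using complex_root_unity_eq[of n j k] assms n by (simp add: cong_def)
  qed (simp add: q_def \<omega>cnj del: complex_cnj_power)
  show ?thesis
  proof (cases "j = k")
    case True
    then show ?thesis using q1 term_q by simp
  next
    case False
    then have "(\<Sum>i<n. q ^ i) = 0"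
      using q1 qn by (simp add: geometric_sum)
    then show ?thesis using False term_q by simp
  qed
qed

lemma circle_mean_norm_square_polynomial:
  assumes "n > 0"
  shows "circle_mean n (\<lambda>w. (cmod (\<Sum>k<n. c k * w ^ k))\<^sup>2) z
       = (\<Sum>k<n. (cmod (c k))\<^sup>2 * cmod z ^ (2 * k))"
proof -
  define \<omega> where "\<omega> = (\<lambda>i. cis (2 * pi * real i / real n))"
  define e where "e = (\<lambda>k. c k * z ^ k)"
  have "complex_of_real (\<Sum>i<n. (cmod (\<Sum>k<n. c k * (\<omega> i * z) ^ k))\<^sup>2)
      = (\<Sum>i<n. \<Sum>j<n. \<Sum>k<n. e j * cnj (e k) * (\<omega> i ^ j * cnj (\<omega> i ^ k)))"
    by (simp add: complex_norm_square sum_product e_def power_mult_distrib mult_ac del: of_real_power)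
  also have "\<dots> = (\<Sum>j<n. \<Sum>i<n. \<Sum>k<n. e j * cnj (e k) * (\<omega> i ^ j * cnj (\<omega> i ^ k)))"
    by (rule sum.swap)
  also have "\<dots> = (\<Sum>j<n. \<Sum>k<n. \<Sum>i<n. e j * cnj (e k) * (\<omega> i ^ j * cnj (\<omega> i ^ k)))"
    by (intro sum.cong refl sum.swap)
  also have "\<dots> = (\<Sum>j<n. \<Sum>k<n. e j * cnj (e k) * (if j = k then of_nat n else 0))"
    unfolding \<omega>_def
    by (intro sum.cong refl) (simp add: sum_roots_of_unity_orthogonal[symmetric] sum_distrib_left del: complex_cnj_power)
  also have "\<dots> = (\<Sum>j<n. e j * cnj (e j) * of_nat n)"
    by (simp add: if_distrib sum.If_cases cong: if_cong)
  also have "\<dots> = complex_of_real (real n * (\<Sum>k<n. (cmod (c k))\<^sup>2 * cmod z ^ (2 * k)))"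
    unfolding of_real_mult[of "real n"] of_real_sum sum_distrib_left
  proof (intro sum.cong refl)
    fix j
    have "e j * cnj (e j) = complex_of_real ((cmod (c j))\<^sup>2 * cmod z ^ (2 * j))"
      unfolding complex_norm_square[symmetric] e_def
      by (simp add: norm_mult norm_power power_mult_distrib mult.commute flip: power_mult)
    then show "e j * cnj (e j) * of_nat n = complex_of_real (real n) * complex_of_real ((cmod (c j))\<^sup>2 * cmod z ^ (2 * j))"
      by (simp only: of_real_of_nat_eq mult.commute)
  qed
  finally have "(\<Sum>i<n. (cmod (\<Sum>k<n. c k * (\<omega> i * z) ^ k))\<^sup>2) = real n * (\<Sum>k<n. (cmod (c k))\<^sup>2 * cmod z ^ (2 * k))"
    unfolding of_real_eq_iff .
  then show ?thesis
    using assms by (simp add: circle_mean_def \<omega>_def)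
qed

lemma circle_mean_abs_diff_le:
  fixes \<phi> \<psi> :: "complex \<Rightarrow> real"
  assumes n: "n > 0" and "\<And>w. cmod w = cmod z \<Longrightarrow> \<bar>\<phi> w - \<psi> w\<bar> \<le> \<epsilon>"
  shows "\<bar>circle_mean n \<phi> z - circle_mean n \<psi> z\<bar> \<le> \<epsilon>"
proof -
  have "\<bar>(\<Sum>i<n. \<phi> (cis (2 * pi * real i / real n) * z) - \<psi> (cis (2 * pi * real i / real n) * z))\<bar> \<le> real n * \<epsilon>"
    by (rule order_trans[OF sum_abs], rule order_trans[OF sum_mono[where g="\<lambda>_. \<epsilon>"]])
       (auto intro!: assms simp: norm_mult)
  moreover have "circle_mean n \<phi> z - circle_mean n \<psi> z
    = (\<Sum>i<n. \<phi> (cis (2 * pi * real i / real n) * z) - \<psi> (cis (2 * pi * real i / real n) * z)) / real n"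
    by (simp add: circle_mean_def sum_subtractf diff_divide_distrib divide_inverse_commute right_diff_distrib)
  ultimately show ?thesis using n by (simp only: abs_divide) (simp add: divide_le_eq mult.commute)
qed

text \<open>
  Parseval's identity on a circle: truncating the power series after \<open>n\<close> terms changes \<open>\<bar>f\<bar>\<^sup>2\<close> uniformly
  little on the circle, and for the truncation the mean over the \<open>n\<close>-th roots of unity is exact.
\<close>

lemma circle_mean_norm_square_power_series:
  assumes sums: "\<And>w. cmod w < 1 \<Longrightarrow> (\<lambda>k. c k * w ^ k) sums f w" and z: "cmod z < 1"
  shows "summable (\<lambda>k. (cmod (c k))\<^sup>2 * cmod z ^ (2 * k))"
    and "(\<lambda>n. circle_mean n (\<lambda>w. (cmod (f w))\<^sup>2) z) \<longlonglongrightarrow> (\<Sum>k. (cmod (c k))\<^sup>2 * cmod z ^ (2 * k))"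
proof -
  define m where "m = (\<lambda>k. cmod (c k) * cmod z ^ k)"
  define r where "r = (cmod z + 1) / 2"
  have r: "cmod z < r" "r < 1" "0 \<le> r" using z by (auto simp: r_def)
  have m: "summable m"
  proof -
    have "summable (\<lambda>k. c k * complex_of_real r ^ k)"
      using sums[of "complex_of_real r"] r by (auto simp: sums_iff)
    from powser_insidea[OF this, of z] r show ?thesis
      by (simp add: m_def norm_mult norm_power)
  qed
  have m0: "m k \<ge> 0" for k by (simp add: m_def)
  define B where "B = suminf m"
  define \<tau> where "\<tau> = (\<lambda>n. suminf (\<lambda>k. m (k + n)))"
  have part: "(\<Sum>k<n. m k) \<le> B" for n
    unfolding B_def by (rule sum_le_suminf[OF m]) (auto simp: m0)
  have B0: "B \<ge> 0" using part[of 0] by simp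
  have \<tau>0: "\<tau> \<longlonglongrightarrow> 0"
    unfolding \<tau>_def using suminf_exist_split2[OF m] by simp
  have close: "\<bar>(cmod (f w))\<^sup>2 - (cmod (\<Sum>k<n. c k * w ^ k))\<^sup>2\<bar> \<le> 2 * B * \<tau> n"
    if w: "cmod w = cmod z" for w n
  proof -
    have mw: "cmod (c k * w ^ k) = m k" for k by (simp add: m_def norm_mult norm_power w)
    have sm: "summable (\<lambda>k. c k * w ^ k)" and fw: "f w = (\<Sum>k. c k * w ^ k)"
      using sums[of w] w z by (auto simp: sums_iff)
    have 1: "cmod (f w) \<le> B"
      unfolding fw B_def using summable_norm[of "\<lambda>k. c k * w ^ k"] m by (simp add: mw)
    have 2: "cmod (\<Sum>k<n. c k * w ^ k) \<le> B"
      by (rule order_trans[OF norm_sum]) (simp add: mw part)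
    have "f w - (\<Sum>k<n. c k * w ^ k) = (\<Sum>k. c (k + n) * w ^ (k + n))"
      unfolding fw using suminf_split_initial_segment[OF sm, of n] by simp
    moreover have "cmod (\<Sum>k. c (k + n) * w ^ (k + n)) \<le> \<tau> n"
      unfolding \<tau>_def using summable_norm[of "\<lambda>k. c (k + n) * w ^ (k + n)"] summable_ignore_initial_segment[OF m, of n]
      by (simp only: mw)
    ultimately have 3: "\<bar>cmod (f w) - cmod (\<Sum>k<n. c k * w ^ k)\<bar> \<le> \<tau> n"
      using norm_triangle_ineq3[of "f w" "\<Sum>k<n. c k * w ^ k"] by simp
    have "\<bar>(cmod (f w))\<^sup>2 - (cmod (\<Sum>k<n. c k * w ^ k))\<^sup>2\<bar>
        = \<bar>cmod (f w) - cmod (\<Sum>k<n. c k * w ^ k)\<bar> * (cmod (f w) + cmod (\<Sum>k<n. c k * w ^ k))"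
      by (simp add: power2_eq_square square_diff_square_factored abs_mult mult.commute)
    also have "\<dots> \<le> \<tau> n * (B + B)"
      using 1 2 3 by (intro mult_mono) auto
    finally show ?thesis by (simp add: algebra_simps)
  qed
  have mB: "m k \<le> B" for k
  proof -
    have "sum m {..<k} \<ge> 0" by (rule sum_nonneg) (rule m0)
    then show "m k \<le> B" using part[of "Suc k"] by simp
  qed
  have "summable (\<lambda>k. m k * m k)"
  proof (rule summable_comparison_test'[where N=0 and g="\<lambda>k. m k * B"])
    show "summable (\<lambda>k. m k * B)" using m by (rule summable_mult2)
    show "norm (m k * m k) \<le> m k * B" for k
      using mult_left_mono[OF mB m0, of k k] by (simp only: real_norm_def abs_of_nonneg mult_nonneg_nonneg m0)
  qed
  moreover have msq: "m k * m k = (cmod (c k))\<^sup>2 * cmod z ^ (2 * k)" for k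
    by (simp add: m_def power2_eq_square mult_ac power_add mult_2 mult_2_right)
  ultimately show sq: "summable (\<lambda>k. (cmod (c k))\<^sup>2 * cmod z ^ (2 * k))" by simp
  have "(\<lambda>n. circle_mean n (\<lambda>w. (cmod (f w))\<^sup>2) z - (\<Sum>k<n. (cmod (c k))\<^sup>2 * cmod z ^ (2 * k))) \<longlonglongrightarrow> 0"
  proof (rule Lim_null_comparison)
    show "\<forall>\<^sub>F n in sequentially. norm (circle_mean n (\<lambda>w. (cmod (f w))\<^sup>2) z - (\<Sum>k<n. (cmod (c k))\<^sup>2 * cmod z ^ (2 * k))) \<le> 2 * B * \<tau> n"
      using eventually_gt_at_top[of 0]
    proof eventually_elim
      case (elim n)
      show ?case
        using circle_mean_abs_diff_le[where z = z and \<phi> = "\<lambda>w. (cmod (f w))\<^sup>2"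
          and \<psi> = "\<lambda>w. (cmod (\<Sum>k<n. c k * w ^ k))\<^sup>2", OF elim close[of _ n]]
        by (simp add: circle_mean_norm_square_polynomial[OF elim])
    qed
    show "(\<lambda>n. 2 * B * \<tau> n) \<longlonglongrightarrow> 0"
      using tendsto_mult_left[OF \<tau>0, of "2 * B"] by simp
  qed
  from tendsto_add[OF this summable_LIMSEQ[OF sq]]
  show "(\<lambda>n. circle_mean n (\<lambda>w. (cmod (f w))\<^sup>2) z) \<longlonglongrightarrow> (\<Sum>k. (cmod (c k))\<^sup>2 * cmod z ^ (2 * k))"
    by simp
qed

text \<open>
  The mean value property follows from Parseval's identity by polarization: \<open>\<bar>f + 1\<bar>\<^sup>2 = \<bar>f\<bar>\<^sup>2 + 2 Re f + 1\<close>, and adding one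
  to \<open>f\<close> alters only the constant coefficient.
\<close>

lemma circle_mean_Re_holomorphic:
  assumes hol: "f holomorphic_on unit_disk" and z: "z \<in> unit_disk"
  shows "(\<lambda>n. circle_mean n (\<lambda>w. Re (f w)) z) \<longlonglongrightarrow> Re (f 0)"
proof -
  define c where "c = (\<lambda>k. (deriv ^^ k) f 0 / fact k)"
  define c' where "c' = c(0 := c 0 + 1)"
  have f: "(\<lambda>k. c k * w ^ k) sums f w" if "cmod w < 1" for w
    using holomorphic_power_series[OF hol, of w] that by (simp add: c_def)
  have f1: "(\<lambda>k. c' k * w ^ k) sums (f w + 1)" if "cmod w < 1" for w
  proof -
    have "(\<lambda>k. c k * w ^ k + (if k = 0 then 1 else 0)) sums (f w + 1)"
      by (intro sums_add f that sums_single)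
    moreover have "c k * w ^ k + (if k = 0 then 1 else 0) = c' k * w ^ k" for k
      by (simp add: c'_def)
    ultimately show ?thesis by simp
  qed
  have zc: "cmod z < 1" using z by simp
  let ?p = "\<lambda>c k. (cmod (c k :: complex))\<^sup>2 * cmod z ^ (2 * k)"
  have c0: "c 0 = f 0" by (simp add: c_def)
  have "(\<lambda>n. circle_mean n (\<lambda>w. (cmod (f w + 1))\<^sup>2) z - circle_mean n (\<lambda>w. (cmod (f w))\<^sup>2) z - 1)
      \<longlonglongrightarrow> suminf (?p c') - suminf (?p c) - 1"
    by (intro tendsto_intros circle_mean_norm_square_power_series f f1 zc)
  moreover have "suminf (?p c') - suminf (?p c) - 1 = 2 * Re (f 0)"
  proof -
    have "suminf (?p c') = (\<Sum>k. ?p c' (Suc k)) + ?p c' 0"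
      using suminf_split_head[OF circle_mean_norm_square_power_series(1)[OF f1 zc]] by simp
    moreover have "suminf (?p c) = (\<Sum>k. ?p c (Suc k)) + ?p c 0"
      using suminf_split_head[OF circle_mean_norm_square_power_series(1)[OF f zc]] by simp
    moreover have "?p c' 0 - ?p c 0 = 2 * Re (f 0) + 1"
      unfolding c'_def c0 by (simp add: cmod_power2) (simp add: power2_eq_square algebra_simps)
    ultimately show ?thesis by (simp add: c'_def)
  qed
  moreover have "circle_mean n (\<lambda>w. (cmod (f w + 1))\<^sup>2) z - circle_mean n (\<lambda>w. (cmod (f w))\<^sup>2) z - 1
      = 2 * circle_mean n (\<lambda>w. Re (f w)) z" if "n > 0" for n
  proof -
    have "(cmod (f w + 1))\<^sup>2 = (cmod (f w))\<^sup>2 + 2 * Re (f w) + 1" for w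
      unfolding cmod_power2 by (simp add: power2_eq_square algebra_simps)
    then show ?thesis using that
      by (simp add: circle_mean_def sum.distrib field_simps flip: sum_distrib_left)
  qed
  ultimately have lim: "(\<lambda>n. circle_mean n (\<lambda>w. (cmod (f w + 1))\<^sup>2) z - circle_mean n (\<lambda>w. (cmod (f w))\<^sup>2) z - 1)
      \<longlonglongrightarrow> 2 * Re (f 0)"
    and eq: "\<And>n. n > 0 \<Longrightarrow> circle_mean n (\<lambda>w. (cmod (f w + 1))\<^sup>2) z - circle_mean n (\<lambda>w. (cmod (f w))\<^sup>2) z - 1
      = 2 * circle_mean n (\<lambda>w. Re (f w)) z"
    by simp_all
  have "(\<lambda>n. 2 * circle_mean n (\<lambda>w. Re (f w)) z) \<longlonglongrightarrow> 2 * Re (f 0)"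
    by (rule Lim_transform_eventually[OF lim eventually_mono[OF eventually_gt_at_top[of 0] eq]])
  from tendsto_mult_left[OF this, of "1/2"] show ?thesis by simp
qed

section \<open>Parseval's identity on the disk\<close>

lemma nn_integral_disk_circle_mean:
  assumes n: "n > 0" and nonneg: "\<And>z. \<phi> z \<ge> 0"
    and [measurable]: "(\<lambda>z. ennreal (\<phi> z) * indicator unit_disk z) \<in> borel_measurable borel"
  shows "(\<integral>\<^sup>+z\<in>unit_disk. ennreal (circle_mean n \<phi> z) \<partial>lborel) = (\<integral>\<^sup>+z\<in>unit_disk. ennreal (\<phi> z) \<partial>lborel)"
proof -
  define \<omega> where "\<omega> = (\<lambda>i. cis (2 * pi * real i / real n))"
  define g where "g = (\<lambda>z. ennreal (\<phi> z) * indicator unit_disk z)"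
  have [measurable]: "g \<in> borel_measurable borel" by (simp add: g_def)
  have "ennreal (circle_mean n \<phi> z) * indicator unit_disk z = (\<Sum>i<n. ennreal (1 / real n) * g (\<omega> i * z))" for z
  proof -
    have "ennreal (circle_mean n \<phi> z) = (\<Sum>i<n. ennreal (1 / real n) * ennreal (\<phi> (\<omega> i * z)))"
      using nonneg by (simp add: circle_mean_def \<omega>_def ennreal_mult sum_nonneg divide_inverse_commute flip: sum_ennreal sum_distrib_left)
    moreover have "(indicator unit_disk (\<omega> i * z) :: ennreal) = indicator unit_disk z" for i
      by (simp add: indicator_def norm_mult \<omega>_def)
    ultimately show ?thesis by (simp add: g_def sum_distrib_right mult.assoc)
  qed
  then have "(\<integral>\<^sup>+z\<in>unit_disk. ennreal (circle_mean n \<phi> z) \<partial>lborel)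
      = (\<Sum>i<n. ennreal (1 / real n) * (\<integral>\<^sup>+z. g (\<omega> i * z) \<partial>lborel))"
    by (simp add: nn_integral_sum nn_integral_cmult)
  also have "\<dots> = (\<Sum>i<n. ennreal (1 / real n) * (\<integral>\<^sup>+z. g z \<partial>lborel))"
    by (simp add: nn_integral_lborel_rotate \<omega>_def)
  also have "\<dots> = of_nat n * ennreal (1 / real n) * (\<integral>\<^sup>+z. g z \<partial>lborel)"
    by (simp add: mult.assoc)
  also have "of_nat n * ennreal (1 / real n) = 1"
    using n by (simp add: ennreal_of_nat_eq_real_of_nat flip: ennreal_mult)
  finally show ?thesis by (simp add: g_def)
qed

text \<open>
  Rotation invariance allows \<open>\<bar>f\<bar>\<^sup>2\<close> to be replaced by its circle means under the integral, and these tend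
  to \<open>\<Sum> \<bar>c\<^sub>k\<bar>\<^sup>2 \<bar>z\<bar>\<^sup>2\<^sup>k\<close>. Fatou's lemma applied to the circle means gives one inequality; applied to the partial sums of
  the series, whose integrals are known exactly, it gives the other.
\<close>

lemma nn_integral_disk_norm_square_power_series:
  assumes sums: "\<And>w. cmod w < 1 \<Longrightarrow> (\<lambda>k. c k * w ^ k) sums f w"
  shows "(\<integral>\<^sup>+z\<in>unit_disk. ennreal ((cmod (f z))\<^sup>2) \<partial>lborel)
       = (\<Sum>k. ennreal (pi / real (Suc k) * (cmod (c k))\<^sup>2))" (is "?I = ?S")
proof -
  define F where "F = (\<lambda>n w. \<Sum>k<n. c k * w ^ k)"
  define m where "m = (\<lambda>k z. ennreal ((cmod (c k))\<^sup>2 * cmod z ^ (2 * k)) * indicator unit_disk z)"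
  have [measurable]: "m k \<in> borel_measurable borel" for k
    unfolding m_def by (intro borel_measurable_continuous_on_disk continuous_intros)
  have "f holomorphic_on unit_disk"
    by (rule power_series_holomorphic[where a = c]) (simp add: sums)
  then have f_meas: "(\<lambda>z. ennreal ((cmod (f z))\<^sup>2) * indicator unit_disk z) \<in> borel_measurable borel"
    by (intro borel_measurable_continuous_on_disk continuous_intros holomorphic_on_imp_continuous_on)
  have F_meas: "(\<lambda>z. ennreal ((cmod (F n z))\<^sup>2) * indicator unit_disk z) \<in> borel_measurable borel" for n
    unfolding F_def by (intro borel_measurable_continuous_on_disk continuous_intros)
  have mint: "(\<integral>\<^sup>+z. m k z \<partial>lborel) = ennreal (pi / real (Suc k) * (cmod (c k))\<^sup>2)" for k
  proof -
    have "(\<integral>\<^sup>+z. m k z \<partial>lborel)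
        = (\<integral>\<^sup>+z. ennreal ((cmod (c k))\<^sup>2) * (ennreal (cmod z ^ (2 * k)) * indicator unit_disk z) \<partial>lborel)"
      by (simp add: m_def ennreal_mult mult.assoc)
    also have "\<dots> = ennreal ((cmod (c k))\<^sup>2) * ennreal (pi / real (Suc k))"
      by (subst nn_integral_cmult)
         (auto simp: nn_integral_disk_norm_power simp del: of_nat_Suc intro!: borel_measurable_continuous_on_disk continuous_intros)
    finally show ?thesis
      by (subst ennreal_mult) (simp_all only: mult.commute zero_le_power2 divide_nonneg_nonneg pi_ge_zero of_nat_0_le_iff)
  qed
  have "?I \<le> ?S"
  proof -
    have "?I = (\<integral>\<^sup>+z. liminf (\<lambda>n. ennreal ((cmod (F n z))\<^sup>2) * indicator unit_disk z) \<partial>lborel)"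
    proof (rule nn_integral_cong)
      fix z
      show "ennreal ((cmod (f z))\<^sup>2) * indicator unit_disk z
          = liminf (\<lambda>n. ennreal ((cmod (F n z))\<^sup>2) * indicator unit_disk z)"
      proof (cases "z \<in> unit_disk")
        case True
        then have "(\<lambda>n. F n z) \<longlonglongrightarrow> f z"
          using sums[of z] by (simp add: F_def sums_def)
        then have "(\<lambda>n. ennreal ((cmod (F n z))\<^sup>2)) \<longlonglongrightarrow> ennreal ((cmod (f z))\<^sup>2)"
          by (intro tendsto_intros)
        from lim_imp_Liminf[OF sequentially_bot this] show ?thesis using True by simp
      qed (simp add: Liminf_const)
    qed
    also have "\<dots> \<le> liminf (\<lambda>n. \<integral>\<^sup>+z\<in>unit_disk. ennreal ((cmod (F n z))\<^sup>2) \<partial>lborel)"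
      using F_meas by (intro nn_integral_liminf) simp
    also have "\<dots> \<le> liminf (\<lambda>n. ?S)"
    proof (rule Liminf_mono, use eventually_gt_at_top[of 0] in eventually_elim)
      case (elim n)
      have "(\<integral>\<^sup>+z\<in>unit_disk. ennreal ((cmod (F n z))\<^sup>2) \<partial>lborel)
          = (\<integral>\<^sup>+z\<in>unit_disk. ennreal (circle_mean n (\<lambda>w. (cmod (F n w))\<^sup>2) z) \<partial>lborel)"
        by (rule nn_integral_disk_circle_mean[symmetric, OF elim _ F_meas]) simp
      also have "\<dots> = (\<integral>\<^sup>+z. (\<Sum>k<n. m k z) \<partial>lborel)"
        by (simp add: F_def circle_mean_norm_square_polynomial[OF elim] m_def flip: sum_distrib_right sum_ennreal)
      also have "\<dots> = (\<Sum>k<n. ennreal (pi / real (Suc k) * (cmod (c k))\<^sup>2))"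
        by (simp add: nn_integral_sum mint)
      also have "\<dots> \<le> ?S"
        by (rule sum_le_suminf) auto
      finally show ?case .
    qed
    finally show ?thesis by (simp add: Liminf_const)
  qed
  moreover have "?S \<le> ?I"
  proof -
    have "?S = (\<integral>\<^sup>+z. (\<Sum>k. m k z) \<partial>lborel)"
      by (simp add: nn_integral_suminf mint)
    also have "\<dots> = (\<integral>\<^sup>+z. liminf (\<lambda>n. ennreal (circle_mean n (\<lambda>w. (cmod (f w))\<^sup>2) z) * indicator unit_disk z) \<partial>lborel)"
    proof (rule nn_integral_cong)
      fix z
      show "(\<Sum>k. m k z) = liminf (\<lambda>n. ennreal (circle_mean n (\<lambda>w. (cmod (f w))\<^sup>2) z) * indicator unit_disk z)"
      proof (cases "z \<in> unit_disk")
        case True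
        then have z: "cmod z < 1" by simp
        note lim = circle_mean_norm_square_power_series[OF sums z]
        have "(\<Sum>k. m k z) = ennreal (\<Sum>k. (cmod (c k))\<^sup>2 * cmod z ^ (2 * k))"
          using True by (simp add: m_def suminf_ennreal2 lim(1))
        also have "\<dots> = liminf (\<lambda>n. ennreal (circle_mean n (\<lambda>w. (cmod (f w))\<^sup>2) z))"
          by (rule lim_imp_Liminf[OF sequentially_bot tendsto_ennrealI[OF lim(2)], symmetric])
        finally show ?thesis using True by simp
      qed (simp add: m_def Liminf_const)
    qed
    also have "\<dots> \<le> liminf (\<lambda>n. \<integral>\<^sup>+z\<in>unit_disk. ennreal (circle_mean n (\<lambda>w. (cmod (f w))\<^sup>2) z) \<partial>lborel)"
    proof (rule nn_integral_liminf)
      fix n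
      have "continuous_on unit_disk f"
        by (rule holomorphic_on_imp_continuous_on) fact
      then have "continuous_on unit_disk (\<lambda>z. f (cis t * z))" for t
        by (rule continuous_on_compose2) (auto intro!: continuous_intros simp: norm_mult)
      then have "(\<lambda>z. ennreal (circle_mean n (\<lambda>w. (cmod (f w))\<^sup>2) z) * indicator unit_disk z) \<in> borel_measurable borel"
        unfolding circle_mean_def
        by (intro borel_measurable_continuous_on_disk continuous_intros)
      then show "(\<lambda>z. ennreal (circle_mean n (\<lambda>w. (cmod (f w))\<^sup>2) z) * indicator unit_disk z) \<in> borel_measurable lborel"
        by simp
    qed
    also have "\<dots> = liminf (\<lambda>n. ?I)"
      by (intro Liminf_eq eventually_mono[OF eventually_gt_at_top[of 0]] nn_integral_disk_circle_mean f_meas) auto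
    finally show ?thesis by (simp add: Liminf_const)
  qed
  ultimately show ?thesis by (rule antisym)
qed

section \<open>Conformal real parts of holomorphic maps\<close>

lemma norm_square_vec: "(norm (x :: 'a::real_normed_vector ^ 'm))\<^sup>2 = (\<Sum>k\<in>UNIV. (norm (x $ k))\<^sup>2)"
  by (simp add: norm_vec_def L2_set_def sum_nonneg)

lemma norm_square_orthogonal_combination:
  assumes "x \<bullet> y = 0" "norm y = norm x"
  shows "(norm (a *\<^sub>R x + b *\<^sub>R y))\<^sup>2 = (norm x)\<^sup>2 * (a\<^sup>2 + b\<^sup>2)"
proof -
  have "y \<bullet> y = x \<bullet> x" using assms(2) by (simp add: norm_eq)
  then show ?thesis
    unfolding power2_norm_eq_inner using assms(1)
    by (simp add: inner_add inner_commute power2_eq_square algebra_simps)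
qed

locale conformal_real_part =
  fixes u :: "complex \<Rightarrow> real ^ 'm" and F :: "complex \<Rightarrow> complex ^ 'm"
  assumes holomorphic: "holomorphic_map_on F unit_disk"
    and real_part: "\<And>z k. z \<in> unit_disk \<Longrightarrow> u z $ k = Re (F z $ k)"
    and conformal: "conformal_map_on u unit_disk"
begin

lemma holomorphic_component: "(\<lambda>z. F z $ k) holomorphic_on unit_disk"
  using holomorphic by (simp add: holomorphic_map_on_def)

lemma deriv_map_holomorphic: "(\<lambda>z. deriv_map F z $ k) holomorphic_on unit_disk"
  by (simp add: deriv_map_def holomorphic_deriv holomorphic_component)

lemma component_derivative:
  "z \<in> unit_disk \<Longrightarrow> ((\<lambda>z. F z $ k) has_field_derivative deriv_map F z $ k) (at z)"
  by (simp add: deriv_map_def holomorphic_derivI[OF holomorphic_component open_ball])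

lemma has_derivative_real_part:
  assumes z: "z \<in> unit_disk"
  shows "(u has_derivative (\<lambda>h. \<chi> k. Re (deriv_map F z $ k * h))) (at z)"
proof -
  have "((\<lambda>z. u z $ k) has_derivative (\<lambda>h. Re (deriv_map F z $ k * h))) (at z)" for k
  proof (rule has_derivative_transform_within_open[where f = "\<lambda>z. Re (F z $ k)", OF _ open_ball z])
    show "((\<lambda>z. Re (F z $ k)) has_derivative (\<lambda>h. Re (deriv_map F z $ k * h))) (at z)"
      using component_derivative[OF z, of k]
      by (intro bounded_linear.has_derivative[OF bounded_linear_Re]) (simp add: has_field_derivative_def)
  qed (simp add: real_part)
  then show ?thesis
    by (subst has_derivative_componentwise_within) (auto simp: Basis_vec_def inner_axis)
qed

lemma
  assumes z: "z \<in> unit_disk"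
  shows D1_real_part: "D1 u z = (\<chi> k. Re (deriv_map F z $ k))"
    and D2_real_part: "D2 u z = (\<chi> k. - Im (deriv_map F z $ k))"
proof -
  note d = has_derivative_real_part[OF z]
  have "((\<lambda>t. u (z + c * complex_of_real t)) has_derivative (\<lambda>t. \<chi> k. Re (deriv_map F z $ k * (c * complex_of_real t)))) (at 0)" for c
  proof -
    have "((\<lambda>t. z + c * complex_of_real t) has_derivative (\<lambda>t. c * complex_of_real t)) (at 0)"
      by (auto intro!: derivative_eq_intros)
    moreover have "(u has_derivative (\<lambda>h. \<chi> k. Re (deriv_map F z $ k * h))) (at (z + c * complex_of_real 0))"
      using d by simp
    ultimately show ?thesis by (rule has_derivative_compose)
  qed
  then have "((\<lambda>t. u (z + c * complex_of_real t)) has_vector_derivative (\<chi> k. Re (deriv_map F z $ k * c))) (at 0)" for c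
    unfolding has_vector_derivative_def by (rule has_derivative_eq_rhs) (auto simp: vec_eq_iff algebra_simps)
  from vector_derivative_at[OF this[of 1]] vector_derivative_at[OF this[of \<i>]]
  show "D1 u z = (\<chi> k. Re (deriv_map F z $ k))" "D2 u z = (\<chi> k. - Im (deriv_map F z $ k))"
    by (simp_all add: D1_def D2_def)
qed

lemma norm_D2: "z \<in> unit_disk \<Longrightarrow> norm (D2 u z) = norm (D1 u z)"
  and D1_D2_orthogonal: "z \<in> unit_disk \<Longrightarrow> D1 u z \<bullet> D2 u z = 0"
  using conformal by (auto simp: conformal_map_on_def)

lemma norm_deriv_map_square:
  assumes z: "z \<in> unit_disk"
  shows "(norm (deriv_map F z))\<^sup>2 = 2 * (norm (D1 u z))\<^sup>2"
proof -
  have "(norm (deriv_map F z))\<^sup>2 = (norm (D1 u z))\<^sup>2 + (norm (D2 u z))\<^sup>2"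
    unfolding norm_square_vec D1_real_part[OF z] D2_real_part[OF z]
    by (simp add: cmod_power2 sum.distrib)
  then show ?thesis by (simp add: norm_D2[OF z])
qed

lemma norm_deriv_map: "z \<in> unit_disk \<Longrightarrow> norm (deriv_map F z) = sqrt 2 * norm (D1 u z)"
  using arg_cong[OF norm_deriv_map_square, of z sqrt] by (simp add: real_sqrt_mult)

lemma area_jacobian_conformal:
  assumes z: "z \<in> unit_disk"
  shows "area_jacobian u z = (norm (D1 u z))\<^sup>2"
proof -
  have "area_jacobian u z = sqrt (((norm (D1 u z))\<^sup>2)\<^sup>2)"
    unfolding area_jacobian_def norm_D2[OF z] D1_D2_orthogonal[OF z] by (simp only: power2_eq_square) simp
  then show ?thesis by (simp only: real_sqrt_abs abs_power2)
qed

lemma norm_differential: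
  assumes z: "z \<in> unit_disk"
  shows "norm (\<chi> k. Re (deriv_map F z $ k * h)) = norm (D1 u z) * cmod h"
proof -
  have "(\<chi> k. Re (deriv_map F z $ k * h)) = Re h *\<^sub>R D1 u z + Im h *\<^sub>R D2 u z"
    by (simp add: D1_real_part[OF z] D2_real_part[OF z] vec_eq_iff algebra_simps)
  moreover have "(norm (Re h *\<^sub>R D1 u z + Im h *\<^sub>R D2 u z))\<^sup>2 = (norm (D1 u z) * cmod h)\<^sup>2"
    using norm_square_orthogonal_combination[OF D1_D2_orthogonal[OF z] norm_D2[OF z]]
    by (simp add: power_mult_distrib cmod_power2)
  ultimately show ?thesis
    by (intro power2_eq_imp_eq[OF _ norm_ge_zero mult_nonneg_nonneg]) (simp_all only: norm_ge_zero)
qed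

lemma max_dilation_conformal:
  assumes z: "z \<in> unit_disk"
  shows "max_dilation u z = norm (D1 u z)"
proof -
  let ?L = "\<lambda>h. \<chi> k. Re (deriv_map F z $ k * h)"
  note d = has_derivative_real_part[OF z]
  have "onorm ?L = norm (D1 u z)"
  proof (rule antisym)
    show "onorm ?L \<le> norm (D1 u z)"
      by (rule onorm_le) (simp only: norm_differential[OF z] order_refl)
    show "norm (D1 u z) \<le> onorm ?L"
      using onorm[OF has_derivative_bounded_linear[OF d], of 1] by (simp only: norm_differential[OF z]) simp
  qed
  then show ?thesis
    using frechet_derivative_at[OF d] by (simp add: max_dilation_def)
qed

lemma surface_area_conformal: "surface_area u = (\<integral>\<^sup>+z\<in>unit_disk. ennreal ((norm (D1 u z))\<^sup>2) \<partial>lborel)"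
  unfolding surface_area_def by (intro nn_integral_cong) (auto simp: indicator_def area_jacobian_conformal)

lemma borel_measurable_norm_D1_square:
  "(\<lambda>z. ennreal ((norm (D1 u z))\<^sup>2) * indicator unit_disk z) \<in> borel_measurable borel"
proof -
  have "(\<lambda>z. ennreal (\<Sum>k\<in>UNIV. (Re (deriv_map F z $ k))\<^sup>2) * indicator unit_disk z) \<in> borel_measurable borel"
    by (intro borel_measurable_continuous_on_disk continuous_on_sum continuous_on_power continuous_on_Re
        holomorphic_on_imp_continuous_on[OF deriv_map_holomorphic])
  also have "(\<lambda>z. ennreal (\<Sum>k\<in>UNIV. (Re (deriv_map F z $ k))\<^sup>2) * indicator unit_disk z)
      = (\<lambda>z. ennreal ((norm (D1 u z))\<^sup>2) * indicator unit_disk z)"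
  proof
    fix z
    show "ennreal (\<Sum>k\<in>UNIV. (Re (deriv_map F z $ k))\<^sup>2) * indicator unit_disk z
        = ennreal ((norm (D1 u z))\<^sup>2) * indicator unit_disk z"
    proof (cases "z \<in> unit_disk")
      case True
      show ?thesis unfolding norm_square_vec D1_real_part[OF True] by simp
    qed simp
  qed
  finally show ?thesis .
qed

lemma nn_integral_double_square:
  "(\<integral>\<^sup>+z\<in>unit_disk. ennreal (2 * (norm (D1 u z))\<^sup>2) \<partial>lborel) = 2 * surface_area u"
proof -
  have "(\<integral>\<^sup>+z\<in>unit_disk. ennreal (2 * (norm (D1 u z))\<^sup>2) \<partial>lborel)
      = (\<integral>\<^sup>+z. 2 * (ennreal ((norm (D1 u z))\<^sup>2) * indicator unit_disk z) \<partial>lborel)"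
    by (intro nn_integral_cong) (simp only: ennreal_mult zero_le_power2 zero_le_numeral ennreal_numeral mult.assoc)
  also have "\<dots> = 2 * surface_area u"
    unfolding surface_area_conformal by (rule nn_integral_cmult) (simp add: borel_measurable_norm_D1_square)
  finally show ?thesis .
qed

lemma dirichlet_conformal: "dirichlet u = 2 * surface_area u"
proof -
  have "(norm (D1 u z))\<^sup>2 + (norm (D2 u z))\<^sup>2 = 2 * (norm (D1 u z))\<^sup>2" if "z \<in> unit_disk" for z
    using norm_D2[OF that] by simp
  then show ?thesis
    unfolding dirichlet_def nn_integral_double_square[symmetric]
    by (intro nn_integral_cong) (metis indicator_simps(2) mult_zero_right)
qed

lemma complex_dirichlet_conformal: "complex_dirichlet F = 2 * surface_area u"
  unfolding complex_dirichlet_def nn_integral_double_square[symmetric]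
  by (intro nn_integral_cong) (metis indicator_simps(2) mult_zero_right norm_deriv_map_square)

end

section \<open>Area, Dirichlet integral and Taylor coefficients\<close>

context conformal_real_part
begin

lemma derivative_power_series:
  assumes expansion: "\<And>z. z \<in> unit_disk \<Longrightarrow> (\<lambda>k. z ^ k *s Fhat k) sums F z" and w: "cmod w < 1"
  shows "(\<lambda>n. (of_nat (Suc n) * Fhat (Suc n) $ j) * w ^ n) sums (deriv_map F w $ j)"
proof -
  have "(\<lambda>n. Fhat n $ j * z ^ n) sums (F z $ j)" if "cmod z < 1" for z
    using bounded_linear.sums[OF bounded_linear_vec_nth expansion, of z j] that by (simp add: mult.commute)
  from termdiffs_sums_strong[OF this component_derivative w] w
  show ?thesis by (simp add: diffs_def)
qed

lemma surface_area_eq_half_complex_dirichlet: "surface_area u = complex_dirichlet F / 2"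
  unfolding complex_dirichlet_conformal by (subst mult.commute) (simp add: mult_divide_eq_ennreal)

lemma surface_area_series:
  assumes expansion: "\<And>z. z \<in> unit_disk \<Longrightarrow> (\<lambda>k. z ^ k *s Fhat k) sums F z"
  shows "surface_area u = ennreal (pi / 2) * (\<Sum>k. ennreal (real (Suc k) * (norm (Fhat (Suc k)))\<^sup>2))"
proof -
  have comp: "(\<integral>\<^sup>+z\<in>unit_disk. ennreal ((cmod (deriv_map F z $ j))\<^sup>2) \<partial>lborel)
      = (\<Sum>k. ennreal (pi * real (Suc k) * (cmod (Fhat (Suc k) $ j))\<^sup>2))" for j
  proof -
    have "pi / real (Suc k) * (cmod (of_nat (Suc k) * Fhat (Suc k) $ j))\<^sup>2 = pi * real (Suc k) * (cmod (Fhat (Suc k) $ j))\<^sup>2" for k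
      unfolding norm_mult norm_of_nat by (simp add: power2_eq_square field_simps)
    then show ?thesis
      by (simp only: nn_integral_disk_norm_square_power_series[OF derivative_power_series[OF expansion]])
  qed
  have "complex_dirichlet F = (\<integral>\<^sup>+z. (\<Sum>j\<in>UNIV. ennreal ((cmod (deriv_map F z $ j))\<^sup>2) * indicator unit_disk z) \<partial>lborel)"
    unfolding complex_dirichlet_def norm_square_vec
    by (intro nn_integral_cong) (simp only: sum_ennreal[symmetric] sum_distrib_right zero_le_power2)
  also have "\<dots> = (\<Sum>j\<in>UNIV. \<integral>\<^sup>+z\<in>unit_disk. ennreal ((cmod (deriv_map F z $ j))\<^sup>2) \<partial>lborel)"
    by (rule nn_integral_sum)
       (simp, intro borel_measurable_continuous_on_disk continuous_on_power continuous_on_norm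
          holomorphic_on_imp_continuous_on[OF deriv_map_holomorphic])
  also have "\<dots> = (\<Sum>k. \<Sum>j\<in>UNIV. ennreal (pi * real (Suc k) * (cmod (Fhat (Suc k) $ j))\<^sup>2))"
    unfolding comp by (rule suminf_sum[symmetric]) simp
  also have "\<dots> = (\<Sum>k. ennreal pi * ennreal (real (Suc k) * (norm (Fhat (Suc k)))\<^sup>2))"
  proof (rule suminf_cong)
    fix k
    have "(\<Sum>j\<in>UNIV. ennreal (pi * real (Suc k) * (cmod (Fhat (Suc k) $ j))\<^sup>2))
        = ennreal (\<Sum>j\<in>UNIV. pi * real (Suc k) * (cmod (Fhat (Suc k) $ j))\<^sup>2)"
      by (rule sum_ennreal) simp
    also have "(\<Sum>j\<in>UNIV. pi * real (Suc k) * (cmod (Fhat (Suc k) $ j))\<^sup>2) = pi * (real (Suc k) * (norm (Fhat (Suc k)))\<^sup>2)"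
      unfolding norm_square_vec sum_distrib_left mult.assoc ..
    finally show "(\<Sum>j\<in>UNIV. ennreal (pi * real (Suc k) * (cmod (Fhat (Suc k) $ j))\<^sup>2))
        = ennreal pi * ennreal (real (Suc k) * (norm (Fhat (Suc k)))\<^sup>2)"
      by (simp only: ennreal_mult' pi_ge_zero)
  qed
  also have "\<dots> = ennreal pi * (\<Sum>k. ennreal (real (Suc k) * (norm (Fhat (Suc k)))\<^sup>2))"
    by (rule ennreal_suminf_cmult)
  also have "ennreal pi = ennreal (pi / 2) * 2"
    using ennreal_mult'[of "pi / 2" 2] by simp
  finally have eq: "complex_dirichlet F = ennreal (pi / 2) * (\<Sum>k. ennreal (real (Suc k) * (norm (Fhat (Suc k)))\<^sup>2)) * 2"
    by (simp only: mult_ac)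
  show ?thesis
    unfolding surface_area_eq_half_complex_dirichlet eq by (rule mult_divide_eq_ennreal) simp_all
qed

text \<open>
  Integrating a constant \<open>F' = a + \<i> b\<close> gives an affine \<open>F\<close>, whose real part has components \<open>u\<^sub>k 0 + a\<^sub>k x - b\<^sub>k y\<close>;
  the relations between \<open>a\<close> and \<open>b\<close> are conformality at the origin.
\<close>

lemma circle_form_of_constant_derivative:
  assumes const: "\<And>z. z \<in> unit_disk \<Longrightarrow> deriv_map F z = deriv_map F 0"
  shows "circle_form_on u unit_disk"
proof -
  define a where "a = D1 u 0"
  define b where "b = - D2 u 0"
  have 0: "0 \<in> unit_disk" by simp
  have ab: "a $ k = Re (deriv_map F 0 $ k)" "b $ k = Im (deriv_map F 0 $ k)" for k
    by (simp_all add: a_def b_def D1_real_part D2_real_part)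
  have F_form: "F z $ k = F 0 $ k + deriv_map F 0 $ k * z" if z: "z \<in> unit_disk" for z k
  proof -
    have "((\<lambda>z. F z $ k - deriv_map F 0 $ k * z) has_field_derivative 0) (at w within unit_disk)" if "w \<in> unit_disk" for w
      using has_field_derivative_at_within[OF DERIV_diff[OF component_derivative[OF that, of k] DERIV_cmult_Id[of "deriv_map F 0 $ k"]], of unit_disk] const[OF that]
      by simp
    from has_field_derivative_zero_constant[OF convex_ball this]
    obtain c where "\<And>w. w \<in> unit_disk \<Longrightarrow> F w $ k - deriv_map F 0 $ k * w = c" by blast
    from this[OF z] this[OF 0] show ?thesis by (simp add: algebra_simps)
  qed
  have form: "u z $ k = u 0 $ k + (a $ k * Re z - b $ k * Im z)" if "z \<in> unit_disk" for z k
    using F_form[OF that, of k] real_part[OF that] real_part[OF 0] by (simp add: ab)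
  have "norm a = norm b" "a \<bullet> b = 0"
    using norm_D2[OF 0] D1_D2_orthogonal[OF 0] by (simp_all add: a_def b_def)
  with form show ?thesis
    unfolding circle_form_on_def by blast
qed

lemma D1_circle_form:
  assumes ab: "\<And>z k. z \<in> unit_disk \<Longrightarrow> u z $ k = u 0 $ k + (a $ k * Re z - b $ k * Im z)" and z: "z \<in> unit_disk"
  shows "D1 u z = a"
proof -
  let ?L = "\<lambda>h. \<chi> k. a $ k * Re h - b $ k * Im h"
  have "bounded_linear ?L"
    unfolding linear_conv_bounded_linear[symmetric]
    by (rule linearI) (simp_all add: vec_eq_iff algebra_simps)
  from has_derivative_add_const[OF bounded_linear_imp_has_derivative[OF this]]
  have "((\<lambda>w. ?L w + u 0) has_derivative ?L) (at z)" .
  then have "(u has_derivative ?L) (at z)"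
    by (rule has_derivative_transform_within_open[OF _ open_ball z]) (intro vec_eq_iff[THEN iffD2] allI, subst ab, simp_all)
  from has_derivative_unique[OF has_derivative_real_part[OF z] this]
  have "(\<chi> k. Re (deriv_map F z $ k * 1)) = ?L 1" by (rule fun_cong)
  then show ?thesis by (simp add: D1_real_part[OF z] vec_eq_iff)
qed

lemma dirichlet_half_eq_surface_area: "dirichlet u / 2 = surface_area u"
  unfolding dirichlet_conformal by (subst mult.commute) (simp add: mult_divide_eq_ennreal)

lemma surface_area_circle_form:
  assumes "circle_form_on u unit_disk"
  shows "surface_area u = ennreal (pi * (max_dilation u 0)\<^sup>2)"
proof -
  obtain a b where ab: "\<And>z k. z \<in> unit_disk \<Longrightarrow> u z $ k = u 0 $ k + (a $ k * Re z - b $ k * Im z)"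
    using assms unfolding circle_form_on_def by blast
  have D1a: "D1 u z = a" if "cmod z < 1" for z
    using D1_circle_form[OF ab] that by simp
  have "surface_area u = (\<integral>\<^sup>+z. ennreal ((norm a)\<^sup>2) * indicator unit_disk z \<partial>lborel)"
    unfolding surface_area_conformal by (intro nn_integral_cong) (auto simp: indicator_def D1a)
  also have "\<dots> = ennreal ((norm a)\<^sup>2) * ennreal pi"
    by (simp add: nn_integral_cmult_indicator emeasure_ball unit_ball_vol_2)
  finally show ?thesis
    by (simp add: max_dilation_conformal D1a ennreal_mult mult.commute)
qed

lemma norm_first_coefficient:
  assumes expansion: "\<And>z. z \<in> unit_disk \<Longrightarrow> (\<lambda>k. z ^ k *s Fhat k) sums F z"
  shows "(norm (Fhat 1))\<^sup>2 = 2 * (max_dilation u 0)\<^sup>2"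
proof -
  have "deriv_map F 0 $ j = Fhat 1 $ j" for j
    using derivative_power_series[OF expansion, of 0 j] by (auto dest: sums_unique2[OF powser_sums_zero])
  then have "deriv_map F 0 = Fhat 1" by (simp add: vec_eq_iff)
  then show ?thesis using norm_deriv_map_square[of 0] by (simp add: max_dilation_conformal)
qed

text \<open>
  By \<open>norm_first_coefficient\<close> the term of index zero in the series for the area is \<open>\<pi> \<Lambda>\<^sup>2\<close>. Finiteness of that term
  makes the cancellation in the equality case legitimate.
\<close>

lemma max_dilation_square_le_surface_area:
  assumes expansion: "\<And>z. z \<in> unit_disk \<Longrightarrow> (\<lambda>k. z ^ k *s Fhat k) sums F z"
  shows "ennreal (pi * (max_dilation u 0)\<^sup>2) \<le> surface_area u"
    and "ennreal (pi * (max_dilation u 0)\<^sup>2) = surface_area u \<Longrightarrow> circle_form_on u unit_disk"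
proof -
  define c where "c = (\<lambda>k. ennreal (real (Suc k) * (norm (Fhat (Suc k)))\<^sup>2))"
  have A: "surface_area u = ennreal (pi / 2) * suminf c"
    unfolding c_def by (rule surface_area_series[OF expansion])
  have c0: "ennreal (pi * (max_dilation u 0)\<^sup>2) = ennreal (pi / 2) * c 0"
    using norm_first_coefficient[OF expansion] by (simp add: c_def flip: ennreal_mult)
  have "sum c {0} \<le> suminf c" by (rule sum_le_suminf) auto
  then show "ennreal (pi * (max_dilation u 0)\<^sup>2) \<le> surface_area u"
    unfolding A c0 by (intro mult_left_mono) auto
  assume "ennreal (pi * (max_dilation u 0)\<^sup>2) = surface_area u"
  then have "c 0 * ennreal (pi / 2) / ennreal (pi / 2) = suminf c * ennreal (pi / 2) / ennreal (pi / 2)"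
    unfolding A c0 by (simp add: mult.commute)
  then have eq: "c 0 = suminf c" by (simp add: mult_divide_eq_ennreal)
  have zero: "Fhat (Suc k) = 0" if "k \<noteq> 0" for k
  proof -
    have "sum c {0, k} \<le> suminf c" by (rule sum_le_suminf) auto
    then have "c 0 + c k \<le> c 0 + 0" using that by (simp add: eq)
    moreover have "c 0 \<noteq> top" by (simp add: c_def)
    ultimately have "c k = 0" by (simp only: ennreal_add_left_cancel_le) simp
    then show ?thesis by (simp add: c_def)
  qed
  show "circle_form_on u unit_disk"
  proof (rule circle_form_of_constant_derivative)
    fix z assume "z \<in> unit_disk"
    then have z: "cmod z < 1" by simp
    have "deriv_map F w $ j = Fhat 1 $ j" if w: "cmod w < 1" for w j
    proof (rule sums_unique2[OF derivative_power_series[OF expansion w]])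
      have "(\<lambda>n. of_nat (Suc n) * Fhat (Suc n) $ j * w ^ n) sums (\<Sum>n\<in>{0}. of_nat (Suc n) * Fhat (Suc n) $ j * w ^ n)"
        by (rule sums_finite) (auto simp: zero)
      then show "(\<lambda>n. of_nat (Suc n) * Fhat (Suc n) $ j * w ^ n) sums (Fhat 1 $ j)" by simp
    qed
    from this[OF z] this[of 0] show "deriv_map F z = deriv_map F 0" by (simp add: vec_eq_iff)
  qed
qed

end

section \<open>A maximum principle for sums of norms\<close>

text \<open>
  On the disk these are the vector-valued harmonic functions. Testing against all vectors \<open>v\<close> treats the real map
  \<open>u\<close> and the complex map \<open>F'\<close> alike, the latter with the real inner product of its target.
\<close>

definition real_part_of_holomorphic :: "(complex \<Rightarrow> 'b::real_inner) \<Rightarrow> bool" where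
  "real_part_of_holomorphic h \<longleftrightarrow>
     (\<forall>v. \<exists>G. G holomorphic_on unit_disk \<and> (\<forall>z\<in>unit_disk. h z \<bullet> v = Re (G z)))"

lemma real_part_of_holomorphic_diff:
  assumes "real_part_of_holomorphic h" "real_part_of_holomorphic k"
  shows "real_part_of_holomorphic (\<lambda>z. h z - k z)"
  unfolding real_part_of_holomorphic_def
proof
  fix v
  obtain G H where "G holomorphic_on unit_disk" "H holomorphic_on unit_disk"
    "\<forall>z\<in>unit_disk. h z \<bullet> v = Re (G z)" "\<forall>z\<in>unit_disk. k z \<bullet> v = Re (H z)"
    using assms unfolding real_part_of_holomorphic_def by meson
  then show "\<exists>G. G holomorphic_on unit_disk \<and> (\<forall>z\<in>unit_disk. (h z - k z) \<bullet> v = Re (G z))"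
    by (intro exI[of _ "\<lambda>z. G z - H z"]) (auto intro!: holomorphic_intros simp: inner_diff_left)
qed

lemma real_part_of_holomorphic_rotate:
  assumes "real_part_of_holomorphic h" and c: "cmod c = 1"
  shows "real_part_of_holomorphic (\<lambda>z. h (c * z))"
  unfolding real_part_of_holomorphic_def
proof
  fix v
  obtain G where G: "G holomorphic_on unit_disk" "\<forall>z\<in>unit_disk. h z \<bullet> v = Re (G z)"
    using assms unfolding real_part_of_holomorphic_def by meson
  have "(\<lambda>z. G (c * z)) holomorphic_on unit_disk"
    unfolding o_def[of G "\<lambda>z. c * z", symmetric]
    by (rule holomorphic_on_compose_gen[OF _ G(1)]) (auto intro!: holomorphic_intros simp: norm_mult c)
  then show "\<exists>G. G holomorphic_on unit_disk \<and> (\<forall>z\<in>unit_disk. h (c * z) \<bullet> v = Re (G z))"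
    using G(2) c by (intro exI[of _ "\<lambda>z. G (c * z)"]) (simp add: norm_mult)
qed

text \<open>
  Freezing the directions of the vectors \<open>h i z\<close> at the given point turns the sum of norms there into the
  real part of one holomorphic function, which elsewhere is at most the sum of norms.
\<close>

lemma sum_norm_maximum_principle:
  fixes h :: "'i \<Rightarrow> complex \<Rightarrow> 'b::real_inner"
  assumes hol: "\<And>i. i \<in> I \<Longrightarrow> real_part_of_holomorphic (h i)"
    and R: "0 < R" "R < 1"
    and bound: "\<And>w. cmod w = R \<Longrightarrow> (\<Sum>i\<in>I. norm (h i w)) \<le> B"
    and z: "cmod z \<le> R"
  shows "(\<Sum>i\<in>I. norm (h i z)) \<le> B"
proof -
  \<comment> \<open>the junk value \<open>v i = 0\<close> for \<open>h i z = 0\<close> is harmless, since that summand vanishes at \<open>z\<close>\<close>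
  define v where "v = (\<lambda>i. h i z /\<^sub>R norm (h i z))"
  have "\<exists>G. G holomorphic_on unit_disk \<and> (\<forall>w\<in>unit_disk. h i w \<bullet> v i = Re (G w))" if "i \<in> I" for i
    using hol[OF that] by (simp add: real_part_of_holomorphic_def)
  then obtain G where G: "\<And>i. i \<in> I \<Longrightarrow> G i holomorphic_on unit_disk"
    "\<And>i w. i \<in> I \<Longrightarrow> w \<in> unit_disk \<Longrightarrow> h i w \<bullet> v i = Re (G i w)" by metis
  define \<Phi> where "\<Phi> = (\<lambda>w. \<Sum>i\<in>I. G i w)"
  have \<Phi>: "\<Phi> holomorphic_on unit_disk"
    unfolding \<Phi>_def by (intro holomorphic_on_sum G)
  have Re\<Phi>: "Re (\<Phi> w) = (\<Sum>i\<in>I. h i w \<bullet> v i)" if "w \<in> unit_disk" for w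
    using that by (simp add: \<Phi>_def G(2))
  have "(\<Sum>i\<in>I. norm (h i z)) = Re (\<Phi> z)"
  proof -
    have "norm (h i z) = h i z \<bullet> v i" for i
      by (cases "h i z = 0") (simp_all add: v_def power2_eq_square flip: power2_norm_eq_inner)
    then show ?thesis using z R by (simp add: Re\<Phi>)
  qed
  also have "\<dots> \<le> B"
  proof (rule maximum_real_frontier[of \<Phi> "cball 0 R"])
    show "\<Phi> holomorphic_on interior (cball 0 R)"
      using R by (intro holomorphic_on_subset[OF \<Phi>]) auto
    show "continuous_on (closure (cball 0 R)) \<Phi>"
      using R by (intro continuous_on_subset[OF holomorphic_on_imp_continuous_on[OF \<Phi>]]) auto
    show "Re (\<Phi> w) \<le> B" if "w \<in> frontier (cball 0 R)" for w
    proof -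
      have w: "cmod w = R" using that R by (simp add: frontier_def)
      have "h i w \<bullet> v i \<le> norm (h i w)" for i
      proof -
        have "norm (v i) \<le> 1" by (cases "h i z = 0") (simp_all add: v_def)
        then show ?thesis
          using norm_cauchy_schwarz[of "h i w" "v i"] mult_left_mono[of "norm (v i)" 1 "norm (h i w)"] by simp
      qed
      then have "(\<Sum>i\<in>I. h i w \<bullet> v i) \<le> (\<Sum>i\<in>I. norm (h i w))" by (intro sum_mono)
      then show ?thesis using Re\<Phi>[of w] bound[OF w] w R by simp
    qed
  qed (use z in auto)
  finally show ?thesis .
qed

section \<open>Inscribed polygons\<close>

lemma sum_shift_periodic:
  fixes e :: "nat \<Rightarrow> real"
  assumes per: "\<And>i. e (i + n) = e i"
  shows "(\<Sum>i<n. e (i + j)) = (\<Sum>i<n. e i)"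
proof (induction j)
  case (Suc j)
  have "(\<Sum>i<n. e (i + j)) + e (n + j) = e j + (\<Sum>i<n. e (i + Suc j))"
    using sum.lessThan_Suc_shift[of "\<lambda>i. e (i + j)" n] by simp
  moreover have "e (n + j) = e j" using per[of j] by (simp add: add.commute)
  ultimately show ?case using Suc by simp
qed simp

text \<open>
  A closed polygon that starts at parameter \<open>s\<close> becomes an inscribed polygon of \<open>[0, 2\<pi>]\<close> after renumbering its vertices
  so that the first one lies in the first arc, and splitting the edge across \<open>2\<pi>\<close> at the base point.
\<close>

lemma inscribed_polygon_le_curve_length:
  fixes g :: "real \<Rightarrow> 'a::metric_space"
  assumes per: "\<And>t. g (t + 2 * pi) = g t" and n: "n > 0" and s: "s \<ge> 0"
  shows "ennreal (\<Sum>i<n. dist (g (s + 2 * pi * real i / real n)) (g (s + 2 * pi * real (Suc i) / real n)))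
       \<le> curve_length g 0 (2 * pi)"
proof -
  define \<delta> where "\<delta> = 2 * pi / real n"
  have \<delta>: "\<delta> > 0" "real n * \<delta> = 2 * pi" using n by (auto simp: \<delta>_def)
  have small: "ennreal (\<Sum>i<n. dist (g (s + \<delta> * real i)) (g (s + \<delta> * real (Suc i)))) \<le> curve_length g 0 (2 * pi)"
    if s: "0 \<le> s" "s \<le> \<delta>" for s
  proof -
    obtain m where m: "n = Suc m" using n by (cases n) auto
    define t where "t = (\<lambda>i. if i = 0 then 0 else if i \<le> n then s + \<delta> * real (i - 1) else 2 * pi)"
    have tS: "t (Suc i) = s + \<delta> * real i" if "i < n" for i using that by (simp add: t_def)
    have t0: "t 0 = 0" and tn: "t (Suc n) = 2 * pi" by (simp_all add: t_def)
    have last: "s + \<delta> * real m \<le> 2 * pi"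
      using s \<delta> by (simp add: m algebra_simps)
    have mono: "t i \<le> t (Suc i)" if "i < Suc n" for i
    proof (cases i)
      case 0 then show ?thesis using n s by (simp add: t0 tS)
    next
      case (Suc j)
      have "Suc j < n \<or> j = m" using that m Suc by auto
      then show ?thesis
      proof
        assume "Suc j < n" then show ?thesis using \<delta> by (simp add: Suc tS algebra_simps)
      next
        assume "j = m" then show ?thesis using last m tn by (simp add: Suc tS)
      qed
    qed
    have "(\<Sum>i<n. dist (g (s + \<delta> * real i)) (g (s + \<delta> * real (Suc i))))
        = (\<Sum>i<m. dist (g (s + \<delta> * real i)) (g (s + \<delta> * real (Suc i)))) + dist (g (s + \<delta> * real m)) (g s)"
    proof -
      have "s + \<delta> * real n = s + 2 * pi" using \<delta>(2) by (simp add: mult.commute)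
      then have "g (s + \<delta> * real (Suc m)) = g s" using per[of s] m by simp
      then show ?thesis by (simp only: m sum.lessThan_Suc)
    qed
    also have "\<dots> \<le> (\<Sum>i<m. dist (g (s + \<delta> * real i)) (g (s + \<delta> * real (Suc i))))
        + (dist (g (s + \<delta> * real m)) (g (2 * pi)) + dist (g 0) (g s))"
      using per[of 0] dist_triangle[of "g (s + \<delta> * real m)" "g s" "g 0"] by simp
    also have "\<dots> = (\<Sum>i<Suc n. dist (g (t i)) (g (t (Suc i))))"
    proof -
      have "(\<Sum>i<Suc n. dist (g (t i)) (g (t (Suc i))))
          = dist (g (t 0)) (g (t 1)) + (\<Sum>i<m. dist (g (t (Suc i))) (g (t (Suc (Suc i))))) + dist (g (t (Suc m))) (g (t (Suc n)))"
        unfolding m by (subst sum.lessThan_Suc_shift) simp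
      moreover have "(\<Sum>i<m. dist (g (t (Suc i))) (g (t (Suc (Suc i)))))
          = (\<Sum>i<m. dist (g (s + \<delta> * real i)) (g (s + \<delta> * real (Suc i))))"
        by (intro sum.cong) (simp_all add: tS m)
      ultimately show ?thesis using tS[of 0] tS[of m] tn t0 m by simp
    qed
    finally have "ennreal (\<Sum>i<n. dist (g (s + \<delta> * real i)) (g (s + \<delta> * real (Suc i))))
        \<le> ennreal (\<Sum>i<Suc n. dist (g (t i)) (g (t (Suc i))))"
      by (rule ennreal_leI)
    also have "\<dots> = (\<Sum>i<Suc n. ennreal (dist (g (t i)) (g (t (Suc i)))))"
      by (rule sum_ennreal[symmetric]) simp
    also have "\<dots> \<le> curve_length g 0 (2 * pi)"
      unfolding curve_length_def
      by (rule SUP_upper2[of "(Suc n, t)"]) (use t0 tn mono in \<open>auto simp del: sum.lessThan_Suc\<close>)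
    finally show ?thesis .
  qed
  \<comment> \<open>the shift that moves the starting parameter into the first of the \<open>n\<close> arcs\<close>
  define j where "j = nat \<lfloor>s / \<delta>\<rfloor>"
  have "real j \<le> s / \<delta>" "s / \<delta> < real j + 1"
    using s \<delta> unfolding j_def by (auto simp: of_nat_nat)
  then have s': "0 \<le> s - \<delta> * real j" "s - \<delta> * real j \<le> \<delta>"
    using \<delta> by (auto simp: field_simps)
  define e where "e = (\<lambda>i. dist (g (s - \<delta> * real j + \<delta> * real i)) (g (s - \<delta> * real j + \<delta> * real (Suc i))))"
  have "e (i + n) = e i" for i
    using per[of "s - \<delta> * real j + \<delta> * real i"] per[of "s - \<delta> * real j + \<delta> * real (Suc i)"] \<delta>(2)
    by (simp add: e_def algebra_simps)
  from sum_shift_periodic[of e n j, OF this] have "(\<Sum>i<n. e (i + j)) = (\<Sum>i<n. e i)" .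
  moreover have "e (i + j) = dist (g (s + 2 * pi * real i / real n)) (g (s + 2 * pi * real (Suc i) / real n))" for i
    by (simp add: e_def algebra_simps) (simp add: \<delta>_def algebra_simps add_divide_distrib)
  ultimately show ?thesis using small[OF s'] by (simp add: e_def)
qed

section \<open>Boundary length and the derivative at the origin\<close>

lemma cmod_cis_minus_one: "cmod (cis t - 1) = 2 * \<bar>sin (t / 2)\<bar>"
  unfolding cis_conv_exp by (rule dist_exp_i_1)

lemma regular_polygon_perimeter_tendsto_2pi:
  "(\<lambda>n. real n * cmod (cis (2 * pi / real n) - 1)) \<longlonglongrightarrow> 2 * pi"
proof -
  have inf: "(\<lambda>n. pi / real n) \<longlonglongrightarrow> 0"
    by (rule lim_const_over_n)
  have "filterlim (\<lambda>n. pi / real n) (at 0) sequentially"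
    using inf by (simp add: filterlim_at eventually_sequentially) (auto intro: exI[of _ 1])
  moreover have "((\<lambda>h. sin h / h) \<longlongrightarrow> (1 :: real)) (at 0)"
    using DERIV_sin[of "0::real"] by (simp add: DERIV_def)
  ultimately have "(\<lambda>n. sin (pi / real n) / (pi / real n)) \<longlonglongrightarrow> 1"
    by (rule filterlim_compose[rotated])
  from tendsto_mult_left[OF tendsto_rabs[OF this], of "2 * pi"]
  have lim: "(\<lambda>n. 2 * pi * \<bar>sin (pi / real n) / (pi / real n)\<bar>) \<longlonglongrightarrow> 2 * pi" by simp
  show ?thesis
  proof (rule Lim_transform_eventually[OF lim])
    show "\<forall>\<^sub>F n in sequentially. 2 * pi * \<bar>sin (pi / real n) / (pi / real n)\<bar> = real n * cmod (cis (2 * pi / real n) - 1)"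
      using eventually_gt_at_top[of 0]
      by eventually_elim (simp add: cmod_cis_minus_one abs_divide abs_mult field_simps)
  qed
qed

lemma boundary_curve_periodic: "boundary_curve u (t + 2 * pi) = boundary_curve u t"
  by (simp add: boundary_curve_def flip: cis_mult)

context conformal_real_part
begin

lemma real_part_of_holomorphic_u: "real_part_of_holomorphic u"
  unfolding real_part_of_holomorphic_def
proof
  fix v
  show "\<exists>G. G holomorphic_on unit_disk \<and> (\<forall>z\<in>unit_disk. u z \<bullet> v = Re (G z))"
    by (intro exI[of _ "\<lambda>z. \<Sum>k\<in>UNIV. F z $ k * complex_of_real (v $ k)"] conjI ballI
          holomorphic_on_sum holomorphic_on_mult holomorphic_component holomorphic_on_const)
       (simp add: inner_vec_def real_part)
qed

lemma real_part_of_holomorphic_deriv_map: "real_part_of_holomorphic (deriv_map F)"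
  unfolding real_part_of_holomorphic_def
proof
  fix v
  show "\<exists>G. G holomorphic_on unit_disk \<and> (\<forall>z\<in>unit_disk. deriv_map F z \<bullet> v = Re (G z))"
    by (intro exI[of _ "\<lambda>z. \<Sum>k\<in>UNIV. deriv_map F z $ k * cnj (v $ k)"] conjI ballI
          holomorphic_on_sum holomorphic_on_mult deriv_map_holomorphic holomorphic_on_const)
       (simp add: inner_vec_def inner_complex_def)
qed

text \<open>
  For \<open>\<bar>z\<bar> = 1\<close> the polygon is inscribed in the boundary curve. Uniform continuity transfers the bound, up to
  \<open>\<epsilon>\<close>, to a circle of radius \<open>R\<close> close to one, and the maximum principle transfers it to the inside of that circle.
\<close>

lemma polygon_le_length:
  assumes cont: "continuous_on (closure unit_disk) u"
    and len: "curve_length (boundary_curve u) 0 (2 * pi) \<le> ennreal L" and L: "0 \<le> L"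
    and n: "n > 0" and z: "cmod z < 1"
  shows "(\<Sum>i<n. norm (u (cis (2 * pi * real (Suc i) / real n) * z) - u (cis (2 * pi * real i / real n) * z))) \<le> L"
proof -
  define \<omega> where "\<omega> = (\<lambda>i. cis (2 * pi * real i / real n))"
  have n\<omega>: "cmod (\<omega> i) = 1" for i by (simp add: \<omega>_def)
  have circle: "(\<Sum>i<n. norm (u (\<omega> (Suc i) * w) - u (\<omega> i * w))) \<le> L" if w: "cmod w = 1" for w
  proof -
    define s where "s = Arg2pi w"
    have s: "s \<ge> 0" "w = cis s"
      using w Arg2pi[of w] by (auto simp: s_def complex_norm_eq_1_exp cis_conv_exp)
    have "\<omega> i * w = cis (s + 2 * pi * real i / real n)" for i
      by (simp add: s(2) \<omega>_def cis_mult add.commute)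
    then have "ennreal (\<Sum>i<n. norm (u (\<omega> (Suc i) * w) - u (\<omega> i * w))) \<le> ennreal L"
      using order_trans[OF inscribed_polygon_le_curve_length[of "boundary_curve u", OF boundary_curve_periodic n s(1)] len]
      by (simp only: boundary_curve_def dist_norm norm_minus_commute)
    then show ?thesis using L by (simp add: ennreal_le_iff)
  qed
  have "(\<Sum>i<n. norm (u (\<omega> (Suc i) * z) - u (\<omega> i * z))) \<le> L + \<epsilon>" if \<epsilon>: "\<epsilon> > 0" for \<epsilon>
  proof -
    have "uniformly_continuous_on (cball 0 1) u"
      using cont by (intro compact_uniformly_continuous) auto
    moreover have "\<epsilon> / (2 * real n) > 0" using \<epsilon> n by simp
    ultimately have "\<exists>\<delta>>0. \<forall>x\<in>cball 0 1. \<forall>y\<in>cball 0 1. cmod (y - x) < \<delta> \<longrightarrow> norm (u y - u x) < \<epsilon> / (2 * real n)"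
      unfolding uniformly_continuous_on_def dist_norm by blast
    then obtain \<delta> where \<delta>: "\<delta> > 0"
      "\<forall>x\<in>cball 0 1. \<forall>y\<in>cball 0 1. cmod (y - x) < \<delta> \<longrightarrow> norm (u y - u x) < \<epsilon> / (2 * real n)"
      by blast
    \<comment> \<open>the lower bound 1/2 keeps \<open>R\<close> positive when \<open>\<delta>\<close> is large\<close>
    define R where "R = max (1/2) (max (cmod z) (1 - \<delta> / 2))"
    have R: "0 < R" "R < 1" "cmod z \<le> R" "1 - R < \<delta>" using z \<delta>(1) by (auto simp: R_def)
    show ?thesis
    proof (rule sum_norm_maximum_principle[where h = "\<lambda>i w. u (\<omega> (Suc i) * w) - u (\<omega> i * w)" and R = R])
      fix i show "real_part_of_holomorphic (\<lambda>w. u (\<omega> (Suc i) * w) - u (\<omega> i * w))"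
        by (intro real_part_of_holomorphic_diff real_part_of_holomorphic_rotate real_part_of_holomorphic_u n\<omega>)
    next
      fix w assume w: "cmod w = R"
      define w' where "w' = w / of_real R"
      have w': "cmod w' = 1" "w = of_real R * w'" using w R by (auto simp: w'_def norm_divide)
      have near: "norm (u (\<omega> i * w) - u (\<omega> i * w')) < \<epsilon> / (2 * real n)" for i
      proof (rule \<delta>(2)[rule_format])
        have "\<omega> i * w - \<omega> i * w' = - (of_real (1 - R) * (\<omega> i * w'))"
          by (simp add: w'(2) algebra_simps)
        then have "cmod (\<omega> i * w - \<omega> i * w') = 1 - R"
          using R w'(1) by (simp only: norm_minus_cancel norm_mult n\<omega> norm_of_real) simp
        then show "cmod (\<omega> i * w - \<omega> i * w') < \<delta>" using R by simp
      qed (use R w w'(1) in \<open>simp_all add: norm_mult n\<omega>\<close>)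
      have "norm (u (\<omega> (Suc i) * w) - u (\<omega> i * w)) \<le> norm (u (\<omega> (Suc i) * w') - u (\<omega> i * w')) + \<epsilon> / real n" for i
      proof -
        have "u (\<omega> (Suc i) * w) - u (\<omega> i * w) = (u (\<omega> (Suc i) * w') - u (\<omega> i * w'))
            + ((u (\<omega> (Suc i) * w) - u (\<omega> (Suc i) * w')) - (u (\<omega> i * w) - u (\<omega> i * w')))" by simp
        then have "norm (u (\<omega> (Suc i) * w) - u (\<omega> i * w)) \<le> norm (u (\<omega> (Suc i) * w') - u (\<omega> i * w'))
            + (norm (u (\<omega> (Suc i) * w) - u (\<omega> (Suc i) * w')) + norm (u (\<omega> i * w) - u (\<omega> i * w')))"
          by (metis norm_triangle_le norm_triangle_ineq4 add_left_mono)
        then show ?thesis using near[of i] near[of "Suc i"] by simp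
      qed
      then have "(\<Sum>i<n. norm (u (\<omega> (Suc i) * w) - u (\<omega> i * w)))
          \<le> (\<Sum>i<n. norm (u (\<omega> (Suc i) * w') - u (\<omega> i * w')) + \<epsilon> / real n)"
        by (intro sum_mono)
      also have "\<dots> \<le> L + \<epsilon>" using circle[OF w'(1)] n by (simp add: sum.distrib)
      finally show "(\<Sum>i<n. norm (u (\<omega> (Suc i) * w) - u (\<omega> i * w))) \<le> L + \<epsilon>" .
    qed (use R in auto)
  qed
  then show ?thesis unfolding \<omega>_def by (rule field_le_epsilon)
qed

text \<open>
  A Taylor estimate for the components of \<open>F\<close> bounds the error of the differential, and by conformality the
  differential stretches \<open>w' - w\<close> by exactly \<open>\<bar>D1 u w\<bar>\<close>.
\<close>

lemma chord_lower_bound: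
  assumes R: "R < 1"
  obtains B where "B \<ge> 0"
    "\<And>w w'. cmod w \<le> R \<Longrightarrow> cmod w' \<le> R \<Longrightarrow>
       norm (D1 u w) * cmod (w' - w) \<le> norm (u w' - u w) + B * (cmod (w' - w))\<^sup>2"
proof -
  have sub: "cball 0 R \<subseteq> unit_disk" using R by auto
  have "\<exists>B. \<forall>w\<in>cball 0 R. cmod ((deriv ^^ 2) (\<lambda>z. F z $ k) w) \<le> B" for k
  proof -
    have "continuous_on (cball 0 R) ((deriv ^^ 2) (\<lambda>z. F z $ k))"
      by (intro holomorphic_on_imp_continuous_on holomorphic_on_subset[OF _ sub]
            holomorphic_higher_deriv holomorphic_component open_ball)
    then have "bounded ((deriv ^^ 2) (\<lambda>z. F z $ k) ` cball 0 R)"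
      by (intro compact_imp_bounded compact_continuous_image compact_cball)
    then show ?thesis unfolding bounded_iff by blast
  qed
  then obtain b where b: "\<And>k w. cmod w \<le> R \<Longrightarrow> cmod ((deriv ^^ 2) (\<lambda>z. F z $ k) w) \<le> b k"
    by (metis mem_cball_0)
  define B where "B = (\<Sum>k\<in>UNIV. \<bar>b k\<bar>)"
  have "norm (D1 u w) * cmod (w' - w) \<le> norm (u w' - u w) + B * (cmod (w' - w))\<^sup>2"
    if w: "cmod w \<le> R" and w': "cmod w' \<le> R" for w w'
  proof -
    have wU: "w \<in> unit_disk" "w' \<in> unit_disk" using w w' R by auto
    define E where "E = u w' - u w - (\<chi> k. Re (deriv_map F w $ k * (w' - w)))"
    have "\<bar>E $ k\<bar> \<le> \<bar>b k\<bar> * (cmod (w' - w))\<^sup>2" for k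
    proof -
      have "cmod ((deriv ^^ 0) (\<lambda>z. F z $ k) w' - (\<Sum>i\<le>1. (deriv ^^ i) (\<lambda>z. F z $ k) w * (w' - w) ^ i / fact i))
          \<le> b k * cmod (w' - w) ^ Suc 1 / fact 1"
      proof (rule complex_Taylor[where S = "cball 0 R"])
        fix i :: nat and x :: complex assume "x \<in> cball 0 R"
        then have "x \<in> unit_disk" using sub by blast
        then show "((deriv ^^ i) (\<lambda>z. F z $ k) has_field_derivative (deriv ^^ Suc i) (\<lambda>z. F z $ k) x) (at x within cball 0 R)"
          unfolding funpow.simps o_def
          by (rule has_field_derivative_at_within[OF
                holomorphic_derivI[OF holomorphic_higher_deriv[OF holomorphic_component open_ball] open_ball]])
      qed (use w w' b in \<open>auto simp: numeral_2_eq_2\<close>)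
      then have "cmod (F w' $ k - F w $ k - deriv_map F w $ k * (w' - w)) \<le> b k * (cmod (w' - w))\<^sup>2"
        by (simp add: deriv_map_def algebra_simps power2_eq_square)
      moreover have "E $ k = Re (F w' $ k - F w $ k - deriv_map F w $ k * (w' - w))"
        by (simp add: E_def real_part[OF wU(1)] real_part[OF wU(2)])
      ultimately have "\<bar>E $ k\<bar> \<le> b k * (cmod (w' - w))\<^sup>2"
        using abs_Re_le_cmod order_trans by metis
      also have "\<dots> \<le> \<bar>b k\<bar> * (cmod (w' - w))\<^sup>2" by (intro mult_right_mono) auto
      finally show ?thesis .
    qed
    then have "norm E \<le> B * (cmod (w' - w))\<^sup>2"
      unfolding B_def sum_distrib_right by (intro order_trans[OF norm_le_l1_cart] sum_mono)
    moreover have "norm (D1 u w) * cmod (w' - w) = norm (u w' - u w - E)"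
      using norm_differential[OF wU(1), of "w' - w"] by (simp add: E_def)
    ultimately show ?thesis
      using norm_triangle_ineq4[of "u w' - u w" E] by simp
  qed
  moreover have "B \<ge> 0" by (simp add: B_def sum_nonneg)
  ultimately show ?thesis by (rule that[rotated])
qed

text \<open>
  On the circle of radius \<open>R\<close>, the edges of the polygon in \<open>polygon_le_length\<close> have parameter distance \<open>R s\<^sub>n\<close> with
  \<open>n s\<^sub>n \<rightarrow> 2 \<pi>\<close>, and \<open>n\<close> quadratic errors of size \<open>s\<^sub>n\<^sup>2\<close> are negligible. This bounds the mean of \<open>\<bar>F'\<bar>\<close>
  by \<open>\<surd>2 L / (2 \<pi> R)\<close> in the limit; the maximum principle removes the dependence on the radius of \<open>z\<close>.
\<close>

lemma circle_mean_deriv_map_le: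
  assumes cont: "continuous_on (closure unit_disk) u"
    and len: "curve_length (boundary_curve u) 0 (2 * pi) \<le> ennreal L" and L: "0 \<le> L"
    and z: "cmod z < 1" and \<epsilon>: "\<epsilon> > 0"
  shows "\<forall>\<^sub>F n in sequentially. circle_mean n (\<lambda>w. norm (deriv_map F w)) z \<le> sqrt 2 * L / (2 * pi) + \<epsilon>"
proof -
  define c where "c = sqrt 2 * L / (2 * pi)"
  have c: "c \<ge> 0" using L by (simp add: c_def)
  \<comment> \<open>any \<open>R\<close> with \<open>\<bar>z\<bar> \<le> R < 1\<close> and \<open>c / R < c + \<epsilon>\<close> will do\<close>
  define M where "M = max (cmod z) (c / (c + \<epsilon>))"
  define R where "R = (M + 1) / 2"
  have "c / (c + \<epsilon>) < 1" using c \<epsilon> by simp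
  then have M: "cmod z \<le> M" "c / (c + \<epsilon>) \<le> M" "M < 1" using z by (auto simp: M_def)
  then have "M < R" "R < 1" by (simp_all add: R_def)
  with M(1,2) have R: "cmod z \<le> R" "R < 1" "c / (c + \<epsilon>) < R"
    by (blast intro: less_imp_le le_less_trans)+
  then have "0 < R" using \<open>M < R\<close> M(1) norm_ge_zero[of z] by linarith
  note R = R this
  then have cR: "c / R < c + \<epsilon>" using c \<epsilon> by (simp add: field_simps)
  obtain B where B: "B \<ge> 0" "\<And>w w'. cmod w \<le> R \<Longrightarrow> cmod w' \<le> R \<Longrightarrow>
       norm (D1 u w) * cmod (w' - w) \<le> norm (u w' - u w) + B * (cmod (w' - w))\<^sup>2"
    using chord_lower_bound[OF R(2)] by blast
  define s where "s = (\<lambda>n. cmod (cis (2 * pi / real n) - 1))"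
  define \<beta> where "\<beta> = (\<lambda>n. sqrt 2 * (L / (R * (real n * s n)) + B * R * s n))"
  have lim1: "(\<lambda>n. real n * s n) \<longlonglongrightarrow> 2 * pi"
    unfolding s_def by (rule regular_polygon_perimeter_tendsto_2pi)
  have lim2: "s \<longlonglongrightarrow> 0"
  proof -
    have "(\<lambda>n. (real n * s n) * (1 / real n)) \<longlonglongrightarrow> 2 * pi * 0"
      by (intro tendsto_mult lim1 lim_1_over_n)
    moreover have "\<forall>\<^sub>F n in sequentially. (real n * s n) * (1 / real n) = s n"
      using eventually_gt_at_top[of 0] by eventually_elim simp
    ultimately have "s \<longlonglongrightarrow> 2 * pi * 0" by (rule Lim_transform_eventually)
    then show ?thesis by simp
  qed
  have "\<beta> \<longlonglongrightarrow> sqrt 2 * (L / (R * (2 * pi)) + B * R * 0)"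
    unfolding \<beta>_def using R by (intro tendsto_intros lim1 lim2) auto
  also have "sqrt 2 * (L / (R * (2 * pi)) + B * R * 0) = c / R"
    using R by (simp add: c_def)
  finally have "\<forall>\<^sub>F n in sequentially. \<beta> n < c + \<epsilon>"
    using cR by (rule order_tendstoD)
  moreover have "\<forall>\<^sub>F n in sequentially. real n * s n > 0"
    using lim1 by (rule order_tendstoD) simp
  ultimately show ?thesis
  proof eventually_elim
    case (elim n)
    have n: "n > 0" using elim(2) by (cases n) auto
    have s: "s n > 0" using elim(2) n by (simp add: zero_less_mult_iff)
    define \<omega> where "\<omega> = (\<lambda>i. cis (2 * pi * real i / real n))"
    have n\<omega>: "cmod (\<omega> i) = 1" for i by (simp add: \<omega>_def)
    have "(\<Sum>i<n. norm (deriv_map F (\<omega> i * z))) \<le> real n * \<beta> n"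
    proof (rule sum_norm_maximum_principle[where R = R])
      fix i show "real_part_of_holomorphic (\<lambda>z. deriv_map F (\<omega> i * z))"
        by (intro real_part_of_holomorphic_rotate real_part_of_holomorphic_deriv_map n\<omega>)
    next
      fix w assume w: "cmod w = R"
      have "norm (D1 u (\<omega> i * w)) * (R * s n) \<le> norm (u (\<omega> (Suc i) * w) - u (\<omega> i * w)) + B * (R * s n)\<^sup>2" for i
      proof -
        have "\<omega> (Suc i) = \<omega> i * cis (2 * pi / real n)"
          by (simp add: \<omega>_def cis_mult algebra_simps add_divide_distrib)
        then have "\<omega> (Suc i) * w - \<omega> i * w = \<omega> i * (cis (2 * pi / real n) - 1) * w"
          by (simp add: algebra_simps)
        then have "cmod (\<omega> (Suc i) * w - \<omega> i * w) = R * s n"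
          by (simp add: norm_mult n\<omega> w s_def)
        then show ?thesis using B(2)[of "\<omega> i * w" "\<omega> (Suc i) * w"] by (simp add: norm_mult n\<omega> w)
      qed
      then have "(\<Sum>i<n. norm (D1 u (\<omega> i * w)) * (R * s n))
          \<le> (\<Sum>i<n. norm (u (\<omega> (Suc i) * w) - u (\<omega> i * w)) + B * (R * s n)\<^sup>2)"
        by (intro sum_mono)
      also have "\<dots> \<le> L + real n * (B * (R * s n)\<^sup>2)"
        using polygon_le_length[OF cont len L n, of w] w R by (simp add: sum.distrib \<omega>_def)
      finally have "(\<Sum>i<n. norm (D1 u (\<omega> i * w))) \<le> (L + real n * (B * (R * s n)\<^sup>2)) / (R * s n)"
        using R s by (simp add: sum_distrib_right[symmetric] pos_le_divide_eq)
      also have "\<dots> = real n * (L / (R * (real n * s n)) + B * R * s n)"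
        using R s n by (simp add: field_simps power2_eq_square)
      finally have "sqrt 2 * (\<Sum>i<n. norm (D1 u (\<omega> i * w))) \<le> sqrt 2 * (real n * (L / (R * (real n * s n)) + B * R * s n))"
        by (rule mult_left_mono) simp
      moreover have "norm (deriv_map F (\<omega> i * w)) = sqrt 2 * norm (D1 u (\<omega> i * w))" for i
        using w R by (intro norm_deriv_map) (simp add: norm_mult n\<omega>)
      ultimately show "(\<Sum>i<n. norm (deriv_map F (\<omega> i * w))) \<le> real n * \<beta> n"
        by (simp add: \<beta>_def sum_distrib_left mult_ac)
    qed (use R in auto)
    then have "circle_mean n (\<lambda>w. norm (deriv_map F w)) z \<le> \<beta> n"
      using n by (simp add: circle_mean_def \<omega>_def field_simps)
    then show ?case using elim(1) by (simp add: c_def)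
  qed
qed

text \<open>
  At the origin every circle mean is the value itself.
\<close>

lemma max_dilation_le_length:
  assumes cont: "continuous_on (closure unit_disk) u"
    and len: "curve_length (boundary_curve u) 0 (2 * pi) \<le> ennreal L" and L: "0 \<le> L"
  shows "2 * pi * max_dilation u 0 \<le> L"
proof -
  have "norm (deriv_map F 0) \<le> sqrt 2 * L / (2 * pi) + \<epsilon>" if "\<epsilon> > 0" for \<epsilon>
  proof -
    have "\<forall>\<^sub>F n in sequentially. circle_mean n (\<lambda>w. norm (deriv_map F w)) 0 \<le> sqrt 2 * L / (2 * pi) + \<epsilon> \<and> n > 0"
      by (rule eventually_conj[OF circle_mean_deriv_map_le[OF cont len L _ that] eventually_gt_at_top]) simp
    then obtain n where "circle_mean n (\<lambda>w. norm (deriv_map F w)) 0 \<le> sqrt 2 * L / (2 * pi) + \<epsilon>" "n > 0"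
      using eventually_happens'[OF sequentially_bot] by blast
    then show ?thesis by (simp add: circle_mean_def flip: mult.assoc)
  qed
  then have "norm (deriv_map F 0) \<le> sqrt 2 * L / (2 * pi)" by (rule field_le_epsilon)
  then have "sqrt 2 * max_dilation u 0 \<le> sqrt 2 * (L / (2 * pi))"
    by (simp add: norm_deriv_map max_dilation_conformal)
  then have "max_dilation u 0 \<le> L / (2 * pi)" by (simp only: mult_le_cancel_left_pos real_sqrt_gt_zero zero_less_numeral)
  then show ?thesis by (simp add: field_simps)
qed

end

section \<open>The case of minimal length\<close>

text \<open>
  The image would otherwise be open, but no subset of the real line is open in the plane except the empty one.
\<close>

lemma real_valued_holomorphic_constant:
  assumes hol: "f holomorphic_on unit_disk" and real: "\<And>z. z \<in> unit_disk \<Longrightarrow> Im (f z) = 0"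
    and z: "z \<in> unit_disk"
  shows "f z = f 0"
proof -
  have "f constant_on unit_disk"
  proof (rule ccontr)
    assume "\<not> f constant_on unit_disk"
    then have "open (f ` unit_disk)"
      by (intro open_mapping_thm[OF hol]) auto
    moreover have "f 0 \<in> f ` unit_disk" by simp
    ultimately obtain e where e: "e > 0" "ball (f 0) e \<subseteq> f ` unit_disk"
      by (meson openE)
    have "f 0 + \<i> * of_real (e / 2) \<in> ball (f 0) e"
      using e(1) by (simp add: dist_norm norm_mult)
    then obtain w where "w \<in> unit_disk" "f w = f 0 + \<i> * of_real (e / 2)"
      using e(2) by (metis imageE subsetD)
    then have "Im (f 0 + \<i> * of_real (e / 2)) = 0" using real[of w] by simp
    then show False using real[of 0] e(1) by simp
  qed
  then show ?thesis using z by (auto simp: constant_on_def)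
qed

text \<open>
  A positive value at \<open>z\<close> would persist on an arc of angle at least \<open>2 \<pi> / q\<close>. For \<open>n = q k\<close> the first \<open>k\<close> rotates lie on this
  arc and are the fraction \<open>1 / q\<close> of all, which keeps the means along multiples of \<open>q\<close> away from zero.
\<close>

lemma vanishing_circle_mean:
  assumes cont: "continuous_on unit_disk K" and nonneg: "\<And>w. w \<in> unit_disk \<Longrightarrow> (0::real) \<le> K w"
    and z: "cmod z < 1"
    and small: "\<And>\<epsilon>. \<epsilon> > 0 \<Longrightarrow> \<forall>\<^sub>F n in sequentially. circle_mean n K z \<le> \<epsilon>"
  shows "K z = 0"
proof (rule ccontr)
  assume "K z \<noteq> 0"
  define \<eta> where "\<eta> = K z"
  have \<eta>: "\<eta> > 0" using nonneg[of z] z \<open>K z \<noteq> 0\<close> by (simp add: \<eta>_def)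
  have "continuous_on UNIV (\<lambda>t. K (cis t * z))"
    by (rule continuous_on_compose2[OF cont]) (use z in \<open>auto intro!: continuous_intros simp: norm_mult\<close>)
  then have "isCont (\<lambda>t. K (cis t * z)) 0"
    by (simp add: continuous_on_eq_continuous_at)
  moreover have "\<eta> / 2 > 0" using \<eta> by simp
  ultimately have "\<exists>\<delta>>0. \<forall>t. dist t 0 < \<delta> \<longrightarrow> dist (K (cis t * z)) (K (cis 0 * z)) < \<eta> / 2"
    unfolding continuous_at_eps_delta by blast
  then obtain \<delta> where \<delta>: "\<delta> > 0" "\<forall>t. dist t 0 < \<delta> \<longrightarrow> dist (K (cis t * z)) (K (cis 0 * z)) < \<eta> / 2"
    by blast
  have large: "K (cis t * z) \<ge> \<eta> / 2" if "\<bar>t\<bar> < \<delta>" for t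
  proof -
    have "\<bar>K (cis t * z) - \<eta>\<bar> < \<eta> / 2"
      using \<delta>(2)[rule_format, of t] that by (simp add: dist_norm \<eta>_def)
    then show ?thesis using abs_ge_minus_self[of "K (cis t * z) - \<eta>"] by linarith
  qed
  obtain q where q: "2 * pi / \<delta> < real q" using reals_Archimedean2 by blast
  moreover have "0 < 2 * pi / \<delta>" using \<delta>(1) by simp
  ultimately have q0: "q > 0" by (metis less_trans of_nat_0_less_iff)
  have "\<eta> / (4 * real q) > 0" using \<eta> q0 by simp
  then obtain N where N: "\<And>n. n \<ge> N \<Longrightarrow> circle_mean n K z \<le> \<eta> / (4 * real q)"
    using small eventually_sequentially by metis
  define k where "k = Suc N"
  have k: "k > 0" "q * k \<ge> N" using q0 mult_le_mono1[of 1 q k] by (auto simp: k_def)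
  have "real k * (\<eta> / 2) = (\<Sum>i<k. \<eta> / 2)" by simp
  also have "\<dots> \<le> (\<Sum>i<k. K (cis (2 * pi * real i / real (q * k)) * z))"
  proof (intro sum_mono large)
    fix i assume "i \<in> {..<k}"
    then have "2 * pi * real i / real (q * k) \<le> 2 * pi * real k / real (q * k)"
      by (intro divide_right_mono mult_left_mono) auto
    also have "\<dots> = 2 * pi / real q" using k by simp
    also have "\<dots> < \<delta>" using q q0 \<delta>(1) by (simp add: field_simps)
    finally show "\<bar>2 * pi * real i / real (q * k)\<bar> < \<delta>" by simp
  qed
  also have "\<dots> \<le> (\<Sum>i<q * k. K (cis (2 * pi * real i / real (q * k)) * z))"
    using q0 z by (intro sum_mono2) (auto intro!: nonneg simp: norm_mult less_le_trans)
  also have "\<dots> = real (q * k) * circle_mean (q * k) K z"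
    using q0 k by (simp add: circle_mean_def field_simps)
  also have "\<dots> \<le> real (q * k) * (\<eta> / (4 * real q))"
    by (intro mult_left_mono N k) simp
  also have "\<dots> = real k * (\<eta> / 4)" using q0 by simp
  finally show False using \<eta> k(1) by simp
qed

lemma circle_mean_diff: "circle_mean n (\<lambda>w. \<phi> w - \<psi> w) z = circle_mean n \<phi> z - circle_mean n \<psi> z"
  by (simp add: circle_mean_def sum_subtractf scaleR_diff_right)

context conformal_real_part
begin

text \<open>
  The function \<open>K = \<bar>F'\<bar> - F' \<bullet> e\<close> is nonnegative by the Cauchy-Schwarz inequality. The means of \<open>\<bar>F'\<bar>\<close> are
  at most \<open>\<bar>F' 0\<bar> + \<epsilon>\<close>, those of \<open>F' \<bullet> e\<close> tend to \<open>\<bar>F' 0\<bar>\<close>, so \<open>K\<close> vanishes, which is the equality case of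
  Cauchy-Schwarz.
\<close>

lemma circle_form_of_minimal_length:
  assumes cont: "continuous_on (closure unit_disk) u"
    and len: "curve_length (boundary_curve u) 0 (2 * pi) \<le> ennreal (2 * pi * max_dilation u 0)"
  shows "circle_form_on u unit_disk"
proof (rule circle_form_of_constant_derivative)
  define f where "f = deriv_map F"
  define c where "c = norm (f 0)"
  have zero: "(0::complex) \<in> unit_disk" by simp
  have L0: "0 \<le> 2 * pi * max_dilation u 0" by (simp add: max_dilation_conformal)
  have c: "sqrt 2 * (2 * pi * max_dilation u 0) / (2 * pi) = c"
    by (simp add: c_def f_def norm_deriv_map max_dilation_conformal)
  obtain e where e: "norm e = 1" "f 0 = c *\<^sub>R e"
  proof (cases "f 0 = 0")
    case True
    \<comment> \<open>any unit vector serves as a direction of the zero vector\<close>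
    obtain e :: "complex ^ 'm" where "norm e = 1" using vector_choose_size[of 1] by auto
    then show ?thesis using True that by (simp add: c_def)
  next
    case False
    then show ?thesis using that[of "f 0 /\<^sub>R c"] by (simp add: c_def)
  qed
  obtain g where g: "g holomorphic_on unit_disk" "\<And>z. z \<in> unit_disk \<Longrightarrow> f z \<bullet> e = Re (g z)"
    using real_part_of_holomorphic_deriv_map unfolding real_part_of_holomorphic_def f_def by meson
  have g0: "Re (g 0) = c"
    using g(2)[OF zero] e by (simp flip: power2_norm_eq_inner)
  define K where "K = (\<lambda>w. norm (f w) - Re (g w))"
  have K: "K w = norm (f w) - f w \<bullet> e" if "w \<in> unit_disk" for w
    using g(2)[OF that] by (simp add: K_def)
  have "K z = 0" if z: "z \<in> unit_disk" for z
  proof (rule vanishing_circle_mean)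
    have "continuous_on unit_disk (\<lambda>w. \<chi> j. f w $ j)"
      unfolding f_def
      by (intro continuous_on_vec_lambda holomorphic_on_imp_continuous_on deriv_map_holomorphic)
    then have "continuous_on unit_disk f" by simp
    then show "continuous_on unit_disk K"
      unfolding K_def by (intro continuous_intros holomorphic_on_imp_continuous_on g(1))
    show "0 \<le> K w" if "w \<in> unit_disk" for w
      using norm_cauchy_schwarz[of "f w" e] by (simp add: K[OF that] e(1))
    show z1: "cmod z < 1" using z by simp
    fix \<epsilon> :: real assume "\<epsilon> > 0"
    then have \<epsilon>: "\<epsilon> / 2 > 0" by simp
    have "\<forall>\<^sub>F n in sequentially. circle_mean n (\<lambda>w. norm (f w)) z \<le> c + \<epsilon> / 2"
      using circle_mean_deriv_map_le[OF cont len L0 z1 \<epsilon>] unfolding c f_def .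
    moreover have "\<forall>\<^sub>F n in sequentially. c - \<epsilon> / 2 < circle_mean n (\<lambda>w. Re (g w)) z"
      using circle_mean_Re_holomorphic[OF g(1) z] \<epsilon> unfolding g0 by (intro order_tendstoD(1)) auto
    ultimately show "\<forall>\<^sub>F n in sequentially. circle_mean n K z \<le> \<epsilon>"
      by eventually_elim (simp add: K_def circle_mean_diff)
  qed
  then have dir: "f z = norm (f z) *\<^sub>R e" if "z \<in> unit_disk" for z
    using norm_cauchy_schwarz_eq[of "f z" e] K[OF that] that e(1) by simp
  obtain j where j: "e $ j \<noteq> 0"
    using e(1) by (metis norm_zero vec_eq_iff zero_index zero_neq_one)
  have quot: "f z $ j / e $ j = complex_of_real (norm (f z))" if "z \<in> unit_disk" for z
  proof -
    have "f z $ j = norm (f z) *\<^sub>R e $ j"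
      using arg_cong[OF dir[OF that], of "\<lambda>x. x $ j"] by (simp only: vector_scaleR_component)
    then show ?thesis using j by (simp add: scaleR_conv_of_real)
  qed
  fix z assume z: "z \<in> unit_disk"
  have "f z $ j / e $ j = f 0 $ j / e $ j"
  proof (rule real_valued_holomorphic_constant[OF _ _ z])
    show "(\<lambda>z. f z $ j / e $ j) holomorphic_on unit_disk"
      unfolding f_def using j by (intro holomorphic_on_divide deriv_map_holomorphic holomorphic_on_const) auto
  qed (simp add: quot)
  then have "norm (f z) = norm (f 0)"
    unfolding quot[OF z] quot[OF zero] by simp
  then show "deriv_map F z = deriv_map F 0"
    using dir[OF z] dir[OF zero] unfolding f_def by simp
qed

text \<open>
  On the unit circle such a map multiplies distances by the norm of \<open>a\<close>, and a chord is at most as long as its arc.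
\<close>

lemma curve_length_circle_form_le:
  assumes form: "circle_form_on u (closure unit_disk)"
  shows "curve_length (boundary_curve u) 0 (2 * pi) \<le> ennreal (2 * pi * max_dilation u 0)"
proof -
  obtain a b where ab: "norm a = norm b" "a \<bullet> b = 0"
    and u: "\<And>z k. z \<in> closure unit_disk \<Longrightarrow> u z $ k = u 0 $ k + (a $ k * Re z - b $ k * Im z)"
    using form unfolding circle_form_on_def by blast
  have "D1 u 0 = a"
    by (rule D1_circle_form[of a b]) (rule u, auto)
  then have a: "max_dilation u 0 = norm a" by (simp add: max_dilation_conformal)
  have dist_le: "dist (boundary_curve u s) (boundary_curve u t) \<le> norm a * (t - s)" if "s \<le> t" for s t
  proof -
    define d where "d = cis s - cis t"
    have "u (cis s) - u (cis t) = Re d *\<^sub>R a + Im d *\<^sub>R (- b)"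
      unfolding vec_eq_iff
    proof
      fix k
      show "(u (cis s) - u (cis t)) $ k = (Re d *\<^sub>R a + Im d *\<^sub>R (- b)) $ k"
        using u[of "cis s" k] u[of "cis t" k] by (simp add: d_def algebra_simps)
    qed
    moreover have "(norm (Re d *\<^sub>R a + Im d *\<^sub>R (- b)))\<^sup>2 = (norm a * cmod d)\<^sup>2"
      unfolding power_mult_distrib cmod_power2
      by (rule norm_square_orthogonal_combination) (simp_all add: ab)
    ultimately have "(norm (u (cis s) - u (cis t)))\<^sup>2 = (norm a * cmod d)\<^sup>2"
      by (simp only:)
    then have "norm (u (cis s) - u (cis t)) = norm a * cmod d"
      by (rule power2_eq_imp_eq) simp_all
    moreover have "cmod d \<le> t - s"
    proof -
      have "d = - (cis s * (cis (t - s) - 1))"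
        by (simp add: d_def algebra_simps cis_mult)
      then have "cmod d = 2 * \<bar>sin ((t - s) / 2)\<bar>"
        by (simp add: norm_mult cmod_cis_minus_one)
      also have "\<dots> \<le> 2 * \<bar>(t - s) / 2\<bar>" by (intro mult_left_mono abs_sin_x_le_abs_x) simp
      finally show ?thesis using that by simp
    qed
    ultimately show ?thesis
      unfolding boundary_curve_def dist_norm by (simp only: mult_left_mono norm_ge_zero)
  qed
  show ?thesis
    unfolding curve_length_def
  proof (rule SUP_least, clarify)
    fix n :: nat and t :: "nat \<Rightarrow> real"
    assume t: "t 0 = 0" "t n = 2 * pi" "\<forall>i<n. t i \<le> t (Suc i)"
    have "(\<Sum>i<n. ennreal (dist (boundary_curve u (t i)) (boundary_curve u (t (Suc i)))))
        = ennreal (\<Sum>i<n. dist (boundary_curve u (t i)) (boundary_curve u (t (Suc i))))"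
      by (rule sum_ennreal) simp
    also have "\<dots> \<le> ennreal (\<Sum>i<n. norm a * (t (Suc i) - t i))"
      using t(3) by (intro ennreal_leI sum_mono dist_le) auto
    also have "(\<Sum>i<n. norm a * (t (Suc i) - t i)) = norm a * (\<Sum>i<n. t (Suc i) - t i)"
      by (rule sum_distrib_left[symmetric])
    also have "\<dots> = 2 * pi * max_dilation u 0"
      unfolding sum_lessThan_telescope a t(1,2) by simp
    finally show "(\<Sum>i<n. ennreal (dist (boundary_curve u (t i)) (boundary_curve u (t (Suc i))))) \<le> ennreal (2 * pi * max_dilation u 0)" .
  qed
qed

end

lemma circle_form_on_closure:
  assumes cont: "continuous_on (closure S) u" and form: "circle_form_on u S"
  shows "circle_form_on u (closure S)"
proof -
  obtain a b where ab: "norm a = norm b" "a \<bullet> b = 0"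
    and u: "\<And>z k. z \<in> S \<Longrightarrow> u z $ k = u 0 $ k + (a $ k * Re z - b $ k * Im z)"
    using form unfolding circle_form_on_def by blast
  have "u z $ k = u 0 $ k + (a $ k * Re z - b $ k * Im z)" if "z \<in> closure S" for z k
  proof -
    have "u z $ k - (a $ k * Re z - b $ k * Im z) = u 0 $ k"
    proof (rule continuous_constant_on_closure[OF _ _ that])
      show "continuous_on (closure S) (\<lambda>z. u z $ k - (a $ k * Re z - b $ k * Im z))"
        by (intro continuous_intros cont)
      show "u w $ k - (a $ k * Re w - b $ k * Im w) = u 0 $ k" if "w \<in> S" for w
        using u[OF that, of k] by linarith
    qed
    then show ?thesis by linarith
  qed
  then show ?thesis using ab unfolding circle_form_on_def by blast
qed

theorem theorem20:
  fixes u :: "complex \<Rightarrow> real ^ 'm"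
    and F :: "complex \<Rightarrow> complex ^ 'm"
    and Fhat :: "nat \<Rightarrow> complex ^ 'm"
  assumes harmonic: "harmonic_map_on u unit_disk"
    and finite_area: "surface_area u < \<infinity>"
    and conformal: "conformal_map_on u unit_disk"
    and holomorphic: "holomorphic_map_on F unit_disk"
    and real_part: "\<And>z k. z \<in> unit_disk \<Longrightarrow> u z $ k = Re (F z $ k)"
    and expansion: "\<And>z. z \<in> unit_disk \<Longrightarrow> (\<lambda>k. z ^ k *s Fhat k) sums F z"
  shows
    "(surface_area u = (\<integral>\<^sup>+z\<in>unit_disk. ennreal ((norm (D1 u z))\<^sup>2) \<partial>lborel)
      \<and> surface_area u = complex_dirichlet F / 2
      \<and> surface_area u =
          ennreal (pi / 2) * (\<Sum>k. ennreal (real (Suc k) * (norm (Fhat (Suc k)))\<^sup>2)))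
   \<and> (ennreal (pi * (max_dilation u 0)\<^sup>2) \<le> dirichlet u
      \<and> ennreal (pi * (max_dilation u 0)\<^sup>2) \<le> dirichlet u / 2
      \<and> (ennreal (pi * (max_dilation u 0)\<^sup>2) = dirichlet u / 2
           \<longleftrightarrow> circle_form_on u unit_disk))
   \<and> (continuous_on (closure unit_disk) u \<and> rectifiable (boundary_curve u) 0 (2 * pi) \<longrightarrow>
        ennreal (2 * pi * max_dilation u 0) \<le> curve_length (boundary_curve u) 0 (2 * pi)
      \<and> (ennreal (2 * pi * max_dilation u 0) = curve_length (boundary_curve u) 0 (2 * pi)
           \<longleftrightarrow> circle_form_on u (closure unit_disk)))"
proof -
  interpret conformal_real_part u F
    by unfold_locales (fact holomorphic, fact real_part, fact conformal)
  let ?\<Lambda> = "max_dilation u 0" and ?L = "curve_length (boundary_curve u) 0 (2 * pi)"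
  note area_bound = max_dilation_square_le_surface_area[OF expansion]
  have "surface_area u \<le> dirichlet u"
    unfolding dirichlet_conformal mult_2 by simp
  then have "ennreal (pi * ?\<Lambda>\<^sup>2) \<le> dirichlet u"
    using area_bound(1) by (rule order_trans[rotated])
  moreover have "ennreal (pi * ?\<Lambda>\<^sup>2) = surface_area u \<longleftrightarrow> circle_form_on u unit_disk"
    using area_bound(2) surface_area_circle_form by auto
  moreover have "ennreal (2 * pi * ?\<Lambda>) \<le> ?L \<and> (ennreal (2 * pi * ?\<Lambda>) = ?L \<longleftrightarrow> circle_form_on u (closure unit_disk))"
    if cont: "continuous_on (closure unit_disk) u" and rect: "rectifiable (boundary_curve u) 0 (2 * pi)"
  proof -
    obtain L where L: "?L = ennreal L" "0 \<le> L"
      using rect unfolding rectifiable_def by (cases ?L) auto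
    have le: "ennreal (2 * pi * ?\<Lambda>) \<le> ?L"
      unfolding L(1) by (intro ennreal_leI max_dilation_le_length[OF cont _ L(2)]) (simp add: L(1))
    have "circle_form_on u (closure unit_disk)" if "ennreal (2 * pi * ?\<Lambda>) = ?L"
      by (intro circle_form_on_closure cont circle_form_of_minimal_length) (simp only: that order_refl)
    moreover have "ennreal (2 * pi * ?\<Lambda>) = ?L" if "circle_form_on u (closure unit_disk)"
      using le curve_length_circle_form_le[OF that] by (rule antisym)
    ultimately show ?thesis using le by blast
  qed
  ultimately show ?thesis
    unfolding dirichlet_half_eq_surface_area
    by (intro conjI impI surface_area_conformal surface_area_eq_half_complex_dirichlet
        surface_area_series[OF expansion] area_bound(1); (elim conjE)?; simp only:)
qed

end
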